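(* Let $K$ be a field, let $R=R(K[X,Y])$, and let $\mathfrak p$ be a height one prime ideal of $R$. Then $R_{\mathfrak p}$ is a Noetherian one-dimensional local domain.
   Context: For an integral domain $T$, the reciprocal complement $R(T)$ is the subring of the fraction field of $T$ generated by all $1/f$ with $f\in T\setminus\{0\}$. Here $K[X,Y]$ is the polynomial ring in two variables over $K$. *)

theory Defs
  imports
    "HOL-Library.Extended_Nat"
    "HOL-Algebra.Generated_Rings"
    "HOL-Algebra.Ring_Divisibility"
    "HOL-Algebra.Algebraic_Closure_Type"
begin

definition reciprocal_complement :: "'a::idom itself \<Rightarrow> 'a fract ring" where
  "reciprocal_complement _ =
     (let F = ring_of_type_algebra :: 'a fract ring
      in F\<lparr>carrier := generate_ring F {1 / to_fract f | f :: 'a. f \<noteq> 0}\<rparr>)"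

(* R is meant to be a subring of the field 'a, with the operations of 'a, and P a prime
   ideal of R. The localization is formed inside that field. *)
definition localization_at :: "'a::field ring \<Rightarrow> 'a set \<Rightarrow> 'a ring" where
  "localization_at R P = R\<lparr>carrier := {a / s | a s. a \<in> carrier R \<and> s \<in> carrier R - P}\<rparr>"

definition prime_chain :: "('a, 'b) ring_scheme \<Rightarrow> nat \<Rightarrow> (nat \<Rightarrow> 'a set) \<Rightarrow> bool" where
  "prime_chain R n Q \<longleftrightarrow> (\<forall>i\<le>n. primeideal (Q i) R) \<and> (\<forall>i<n. Q i \<subset> Q (Suc i))"

definition height :: "('a, 'b) ring_scheme \<Rightarrow> 'a set \<Rightarrow> enat" where
  "height R P = (SUP n \<in> {n. \<exists>Q. prime_chain R n Q \<and> Q n = P}. enat n)"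

(* The zero ring gets dimension 0 here, because Sup {} = 0 in enat. *)
definition krull_dim :: "('a, 'b) ring_scheme \<Rightarrow> enat" where
  "krull_dim R = (SUP n \<in> {n. \<exists>Q. prime_chain R n Q}. enat n)"

locale local_ring = cring +
  assumes unique_maximal: "\<exists>!M. maximalideal M R"

end

theory Submission
  imports Defs
begin

text \<open>
  Write D = K[X,Y], let R be its reciprocal complement and P a prime of height one. The
  polynomials f with \<open>1/f \<notin> P\<close> form, together with 0, a subring A of D
  (\<open>inverted_factorially_closed\<close>): for sums this is the identity 1/a * 1/b = 1/(a+b)
  * (1/a + 1/b). The subring contains K and every divisor of each of its nonzero elements, and its
  nonzero elements are units of the localization S of R at P.

  The height hypothesis forces A to lie strictly between K and D. As P is not 0, some f lies
  outside A; put \<open>\<pi> = 1/f\<close>. Moreover A contains a nonconstant g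
  (\<open>exists_inverted_nonconstant\<close>). Otherwise P would contain 1/f for all nonconstant
  f. But the elements of R of positive value for the valuation given by the negated degree in Y
  form a nonzero prime that misses 1/X, and a finer valuation, which also takes into account the
  degree in X of the leading coefficient, shows that in this case the prime lies inside P. So
  there would be a chain of primes of length two that ends at P.

  The rest is the argument of Krull and Akizuki over the ring of polynomials in
  \<open>\<pi>\<close> with coefficients in the fraction field of A, and all finiteness in it
  comes from a dimension count. There is an N, depending only on f and g, such that any N + 1
  elements \<open>n\<^sub>0, \<dots>, n\<^sub>N\<close> of D satisfy a nontrivial relation
  \<open>\<Sum>a\<^sub>k(f) n\<^sub>k = 0\<close> in which the \<open>a\<^sub>k\<close> are
  polynomials over A (\<open>dependent_over_polynomials_in\<close>). Indeed, for large M the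
  \<open>(N + 1) M\<^sup>2\<close> products \<open>g\<^sup>i f\<^sup>j n\<^sub>k\<close> with i, j
  < M lie in a space of dimension at most \<open>N M\<^sup>2\<close>. The relation has two
  consequences.

  First, dividing it by the highest power of f that occurs and reading it modulo
  \<open>\<pi>\<close> bounds the dimension of \<open>S/\<pi>S\<close> over the fraction field of
  A (\<open>dependent_mod_pi\<close>). Second, applied to the powers of an element F of D it
  exhibits a nonzero multiple of F in D that is a polynomial in f over A, that is, an element of S
  times a power of f. As a nonzero ideal of S contains 1/F for some F, it contains a power of
  \<open>\<pi>\<close> (\<open>nonzero_ideal_contains_pi_power\<close>). An induction on the
  exponent then shows that each nonzero ideal is finitely generated
  (\<open>ideal_with_pi_power_fg\<close>).

  Finally, a nonzero prime of S contracts to a nonzero prime of R inside P. By the height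
  hypothesis the contraction is P, so the prime is the maximal ideal of S, and S has dimension
  one.
\<close>

section \<open>Linear dependence over the polynomials in two fixed elements\<close>

text \<open>
  Gaussian elimination: an equation in which some coefficient is nonzero is used to eliminate one
  unknown, and the solution of the smaller system is extended by the value which that equation forces.
\<close>

lemma underdetermined_system_nontrivial_solution:
  fixes a :: "'i \<Rightarrow> 'j \<Rightarrow> 'k::field"
  assumes "finite J" "finite I" "card J < card I"
  shows "\<exists>c. (\<exists>i\<in>I. c i \<noteq> 0) \<and> (\<forall>j\<in>J. (\<Sum>i\<in>I. c i * a i j) = 0)"
  using assms
proof (induction J arbitrary: I a rule: finite_induct)
  case empty
  then obtain i where "i \<in> I" by fastforce
  then show ?case by (intro exI[of _ "\<lambda>_. 1"]) auto
next
  case (insert j J)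
  show ?case
  proof (cases "\<forall>i\<in>I. a i j = 0")
    case True
    have "card J < card I" using insert by simp
    obtain c where "\<exists>i\<in>I. c i \<noteq> 0" "\<forall>j\<in>J. (\<Sum>i\<in>I. c i * a i j) = 0"
      using insert.IH[OF insert.prems(1) \<open>card J < card I\<close>, of a] by (elim exE conjE)
    moreover have "(\<Sum>i\<in>I. c i * a i j) = 0" using True by simp
    ultimately show ?thesis by (intro exI[of _ c]) simp
  next
    case False
    then obtain k where k: "k \<in> I" "a k j \<noteq> 0" by blast
    define I' where "I' = I - {k}"
    have fI': "finite I'" and cI': "card J < card I'" and I: "I = insert k I'" "k \<notin> I'"
      using insert k by (auto simp: I'_def)
    obtain c where c: "\<exists>i\<in>I'. c i \<noteq> 0"
      "\<forall>j'\<in>J. (\<Sum>i\<in>I'. c i * (a i j' - a i j / a k j * a k j')) = 0"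
      using insert.IH[OF fI' cI', of "\<lambda>i j'. a i j' - a i j / a k j * a k j'"] by blast
    define c' where "c' = c(k := - (\<Sum>i\<in>I'. c i * a i j) / a k j)"
    have sum: "(\<Sum>i\<in>I. c' i * a i j') = (\<Sum>i\<in>I'. c i * (a i j' - a i j / a k j * a k j'))" for j'
    proof -
      have "(\<Sum>i\<in>I'. c' i * a i j') = (\<Sum>i\<in>I'. c i * a i j')"
        using I(2) by (intro sum.cong) (auto simp: c'_def)
      then have "(\<Sum>i\<in>I. c' i * a i j') =
          (\<Sum>i\<in>I'. c i * a i j') - (\<Sum>i\<in>I'. c i * a i j) / a k j * a k j'"
        using I fI' by (simp add: c'_def)
      also have "(\<Sum>i\<in>I'. c i * a i j) / a k j * a k j' = (\<Sum>i\<in>I'. c i * (a i j / a k j * a k j'))"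
        by (simp add: sum_divide_distrib sum_distrib_right mult.assoc)
      finally show ?thesis by (simp add: sum_subtractf right_diff_distrib)
    qed
    have "(\<Sum>i\<in>I'. c i * (a i j - a i j / a k j * a k j)) = 0"
      using k by simp
    then have "\<forall>j'\<in>insert j J. (\<Sum>i\<in>I. c' i * a i j') = 0" using sum c(2) by simp
    moreover have "\<exists>i\<in>I. c' i \<noteq> 0" using c(1) I by (auto simp: c'_def)
    ultimately show ?thesis by blast
  qed
qed

text \<open>
  The bound is imposed on the degrees in the two variables separately, so that the dimension is
  exactly \<open>(m + 1)\<^sup>2\<close> and the bounds add under multiplication.
\<close>

definition box :: "nat \<Rightarrow> 'k::field poly poly set" where
  "box m = {q. degree q \<le> m \<and> (\<forall>i. degree (coeff q i) \<le> m)}"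

abbreviation scalar :: "'k::field \<Rightarrow> 'k poly poly" where
  "scalar c \<equiv> [:[:c:]:]"

lemma box_mono: "m \<le> n \<Longrightarrow> box m \<subseteq> box n"
  unfolding box_def using order_trans by blast

lemma in_some_box: "\<exists>m. q \<in> box m"
proof -
  define m where "m = max (degree q) (Max ((\<lambda>i. degree (coeff q i)) ` {..degree q}))"
  have "degree (coeff q i) \<le> m" for i
  proof (cases "i \<le> degree q")
    case True
    then have "degree (coeff q i) \<le> Max ((\<lambda>i. degree (coeff q i)) ` {..degree q})"
      by (intro Max_ge) auto
    then show ?thesis by (simp add: m_def)
  qed (simp add: coeff_eq_0)
  moreover have "degree q \<le> m" by (simp add: m_def)
  ultimately show ?thesis unfolding box_def by blast
qed

lemma box_mult:
  assumes "p \<in> box m" "q \<in> box n"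
  shows "p * q \<in> box (m + n)"
proof -
  have "degree (coeff (p * q) i) \<le> m + n" for i
    unfolding coeff_mult
  proof (rule degree_sum_le)
    fix k
    have "degree (coeff p k) + degree (coeff q (i - k)) \<le> m + n"
      using assms by (auto simp: box_def intro: add_mono)
    then show "degree (coeff p k * coeff q (i - k)) \<le> m + n"
      using degree_mult_le order_trans by blast
  qed simp
  moreover have "degree (p * q) \<le> m + n"
    using degree_mult_le[of p q] assms by (auto simp: box_def)
  ultimately show ?thesis by (simp add: box_def)
qed

lemma box_power: "p \<in> box m \<Longrightarrow> p ^ i \<in> box (i * m)"
proof (induction i)
  case 0
  show ?case by (auto simp: box_def)
next
  case (Suc i)
  then show ?case using box_mult[of p m "p ^ i" "i * m"] by simp
qed

lemma box_linear_dependence: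
  fixes q :: "'i \<Rightarrow> 'k::field poly poly"
  assumes "finite I" "\<And>i. i \<in> I \<Longrightarrow> q i \<in> box m" "(m + 1)\<^sup>2 < card I"
  shows "\<exists>c. (\<exists>i\<in>I. c i \<noteq> 0) \<and> (\<Sum>i\<in>I. scalar (c i) * q i) = 0"
proof -
  define J where "J = {..m} \<times> {..m}"
  have "card J < card I" using assms(3) by (simp add: J_def power2_eq_square)
  then obtain c where c: "\<exists>i\<in>I. c i \<noteq> 0"
      "\<forall>(u,v)\<in>J. (\<Sum>i\<in>I. c i * coeff (coeff (q i) u) v) = 0"
    using underdetermined_system_nontrivial_solution
      [of J I "\<lambda>i (u,v). coeff (coeff (q i) u) v"] assms(1)
    by (auto simp: J_def split_beta)
  have "coeff (coeff (\<Sum>i\<in>I. scalar (c i) * q i) u) v = 0" for u v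
  proof (cases "(u, v) \<in> J")
    case True
    then show ?thesis using c(2) by (auto simp: coeff_sum)
  next
    case False
    have "coeff (coeff (q i) u) v = 0" if "i \<in> I" for i
    proof (cases "u \<le> m")
      case True
      then have "m < v" using False by (simp add: J_def)
      moreover have "degree (coeff (q i) u) \<le> m" using assms(2)[OF that] by (simp add: box_def)
      ultimately show ?thesis by (simp add: coeff_eq_0)
    next
      case False
      then show ?thesis using assms(2)[OF that] by (simp add: box_def coeff_eq_0)
    qed
    then show ?thesis by (simp add: coeff_sum)
  qed
  then have "(\<Sum>i\<in>I. scalar (c i) * q i) = 0" by (intro poly_eqI) simp
  with c(1) show ?thesis by blast
qed

text \<open>
  The number \<open>N\<close> does not depend on the family \<open>n\<close>: if f and g have degrees at most d in each variable,
  the products with exponents below M number \<open>(N + 1) M\<^sup>2\<close>, whereas the box that contains them has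
  dimension \<open>(2dM + e + 1)\<^sup>2\<close>, where e bounds the degrees of the \<open>n k\<close>. A large M absorbs e, so
  \<open>N = (2d + 1)\<^sup>2\<close> works.
\<close>

lemma polynomials_dependent_over_two:
  fixes f g :: "'k::field poly poly"
  shows "\<exists>N::nat. \<forall>n :: nat \<Rightarrow> 'k poly poly. \<exists>M (c :: nat \<Rightarrow> nat \<Rightarrow> nat \<Rightarrow> 'k). (\<exists>k\<le>N. \<exists>i<M. \<exists>j<M. c k i j \<noteq> 0) \<and>
     (\<Sum>k\<le>N. \<Sum>j<M. \<Sum>i<M. scalar (c k i j) * (g ^ i * f ^ j * n k)) = 0"
proof -
  obtain d1 where "f \<in> box d1" using in_some_box[of f] by (elim exE)
  moreover obtain d2 where "g \<in> box d2" using in_some_box[of g] by (elim exE)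
  moreover define d where "d = d1 + d2"
  ultimately have d: "f \<in> box d" "g \<in> box d"
    using subsetD[OF box_mono[of d1 d]] subsetD[OF box_mono[of d2 d]] by simp_all
  define N where "N = (2 * d + 1)\<^sup>2"
  have "\<exists>M (c :: nat \<Rightarrow> nat \<Rightarrow> nat \<Rightarrow> 'k). (\<exists>k\<le>N. \<exists>i<M. \<exists>j<M. c k i j \<noteq> 0) \<and>
     (\<Sum>k\<le>N. \<Sum>j<M. \<Sum>i<M. scalar (c k i j) * (g ^ i * f ^ j * n k)) = 0"
    for n :: "nat \<Rightarrow> 'k poly poly"
  proof -
    define e' where "e' k = (SOME m. n k \<in> box m)" for k
    have e': "n k \<in> box (e' k)" for k
      unfolding e'_def using someI_ex[OF in_some_box] .
    define e where "e = Max (e' ` {..N})"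
    have e: "n k \<in> box e" if "k \<le> N" for k
      using e'[of k] box_mono[of "e' k" e] that by (auto simp: e_def)
    \<comment> \<open>with this value of \<open>M\<close> the dimension of the box is exactly \<open>N * M\<^sup>2\<close>\<close>
    define M where "M = e + 1"
    define I where "I = {..N} \<times> {..<M} \<times> {..<M}"
    define q where "q = (\<lambda>(k, j, i). g ^ i * f ^ j * n k)"
    have q_box: "q x \<in> box (M * d + M * d + e)" if "x \<in> I" for x
    proof -
      obtain k j i where x: "x = (k, j, i)" by (cases x)
      with that have kji: "k \<le> N" "j < M" "i < M" by (auto simp: I_def)
      have "g ^ i \<in> box (M * d)"
        using box_power[OF d(2), of i] box_mono[of "i * d" "M * d"] kji by auto
      moreover have "f ^ j \<in> box (M * d)"
        using box_power[OF d(1), of j] box_mono[of "j * d" "M * d"] kji by auto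
      ultimately show ?thesis using e[OF kji(1)] by (simp add: x q_def box_mult)
    qed
    have card_I: "(M * d + M * d + e + 1)\<^sup>2 < card I"
    proof -
      have "M * d + M * d + e + 1 = (2 * d + 1) * M" by (simp add: M_def algebra_simps)
      then have "(M * d + M * d + e + 1)\<^sup>2 = N * (M * M)"
        by (simp only: N_def power_mult_distrib power2_eq_square[of M])
      also have "\<dots> < (N + 1) * (M * M)"
        by (intro mult_strict_right_mono) (simp_all add: M_def)
      also have "\<dots> = card I" by (simp add: I_def)
      finally show ?thesis .
    qed
    have "finite I" by (simp add: I_def)
    have "\<exists>c. (\<exists>x\<in>I. c x \<noteq> 0) \<and> (\<Sum>x\<in>I. scalar (c x) * q x) = 0"
      by (rule box_linear_dependence[OF \<open>finite I\<close> q_box card_I])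
    then obtain c where c: "\<exists>x\<in>I. c x \<noteq> 0" "(\<Sum>x\<in>I. scalar (c x) * q x) = 0"
      by (elim exE conjE)
    have "(\<Sum>k\<le>N. \<Sum>j<M. \<Sum>i<M. scalar (c (k, j, i)) * (g ^ i * f ^ j * n k))
        = (\<Sum>x\<in>I. scalar (c x) * q x)"
      by (simp only: I_def q_def sum.cartesian_product case_prod_beta' fst_conv snd_conv
          prod.collapse)
    moreover have "\<exists>k\<le>N. \<exists>i<M. \<exists>j<M. c (k, j, i) \<noteq> 0"
      using c(1) by (auto simp: I_def)
    ultimately have "(\<exists>k\<le>N. \<exists>i<M. \<exists>j<M. c (k, j, i) \<noteq> 0) \<and>
        (\<Sum>k\<le>N. \<Sum>j<M. \<Sum>i<M. scalar (c (k, j, i)) * (g ^ i * f ^ j * n k)) = 0"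
      using c(2) by (simp only: simp_thms)
    then show ?thesis
      by - (rule exI[of _ M], rule exI[of _ "\<lambda>k i j. c (k, j, i)"], assumption)
  qed
  note dep = this
  show ?thesis by (rule exI[of _ N], rule allI, rule dep)
qed

text \<open>
  Closure under divisors is what makes the elements outside the subring transcendental over it.
\<close>

locale factorially_closed =
  fixes A :: "'k::field poly poly set"
  assumes scalar_mem: "scalar c \<in> A"
    and add_mem: "a \<in> A \<Longrightarrow> b \<in> A \<Longrightarrow> a + b \<in> A"
    and mult_mem: "a \<in> A \<Longrightarrow> b \<in> A \<Longrightarrow> a * b \<in> A"
    and factor_mem: "a * b \<in> A \<Longrightarrow> a * b \<noteq> 0 \<Longrightarrow> a \<in> A"
begin

lemma zero_mem: "0 \<in> A"
  using scalar_mem[of 0] by simp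

lemma sum_mem: "(\<And>i. i \<in> I \<Longrightarrow> h i \<in> A) \<Longrightarrow> (\<Sum>i\<in>I. h i) \<in> A"
  by (induction I rule: infinite_finite_induct) (auto intro: zero_mem add_mem)

lemma power_mem: "a \<in> A \<Longrightarrow> a ^ n \<in> A"
  using scalar_mem[of 1] by (induction n) (auto intro: mult_mem simp flip: one_pCons)

text \<open>
  In a relation \<open>a\<^sub>0 + a\<^sub>1 f + \<dots> = 0\<close> the element f divides the constant coefficient. As that
  coefficient is in \<open>A\<close> and f is not, it vanishes, and f can be cancelled.
\<close>

lemma outside_transcendental:
  assumes "f \<notin> A" "\<And>i. coeff p i \<in> A" "poly p f = 0"
  shows "p = 0"
  using assms(2,3)
proof (induction p)
  case (pCons a p)
  have a: "a \<in> A" using pCons.prems(1)[of 0] by simp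
  have eq: "a = f * (- poly p f)" using pCons.prems(2) by (simp add: eq_neg_iff_add_eq_0)
  have "a = 0"
  proof (rule ccontr)
    assume "a \<noteq> 0"
    then have "f \<in> A" using factor_mem[of f "- poly p f"] eq a by metis
    with assms(1) show False by simp
  qed
  moreover have "f \<noteq> 0" using assms(1) zero_mem by auto
  ultimately have "poly p f = 0" using eq by simp
  moreover have "coeff p i \<in> A" for i using pCons.prems(1)[of "Suc i"] by simp
  ultimately show ?case using pCons.IH \<open>a = 0\<close> by simp
qed simp

end

text \<open>
  Transcendence over the constants, an instance of \<open>outside_transcendental\<close>, is what keeps the
  coefficients \<open>\<Sum>c\<^sub>i g\<^sup>i\<close> from vanishing in the next lemma.
\<close>

lemma factorially_closed_scalars: "factorially_closed (range (scalar :: 'k::field \<Rightarrow> _))"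
proof
  fix a b :: "'k poly poly"
  assume ab: "a * b \<in> range scalar" "a * b \<noteq> 0"
  then obtain c where c: "a * b = scalar c" by auto
  with ab have "c \<noteq> 0" by auto
  then have "a * (b * scalar (1 / c)) = 1"
    using c by (simp add: mult.assoc[symmetric] one_pCons)
  then have "a dvd 1" by (metis dvdI)
  then obtain p where p: "a = [:p:]" "p dvd 1" by (auto simp: is_unit_poly_iff)
  then obtain d where "p = [:d:]" by (auto simp: is_unit_poly_iff)
  with p show "a \<in> range scalar" by auto
qed auto

context factorially_closed begin

text \<open>
  The relation of \<open>polynomials_dependent_over_two\<close> is collected by powers of f; its coefficients
  are polynomials in g over K, hence elements of \<open>A\<close>, and not all of them vanish because g is
  transcendental over K.
\<close>

lemma dependent_over_polynomials_in:
  assumes g: "g \<in> A" "g \<notin> range scalar"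
  shows "\<exists>N::nat. \<forall>n :: nat \<Rightarrow> 'k poly poly. \<exists>a. (\<forall>k\<le>N. \<forall>j. coeff (a k) j \<in> A) \<and> (\<exists>k\<le>N. a k \<noteq> 0) \<and>
     (\<Sum>k\<le>N. poly (a k) f * n k) = 0"
proof -
  interpret K: factorially_closed "range (scalar :: 'k \<Rightarrow> _)" by (rule factorially_closed_scalars)
  obtain N :: nat where "\<forall>n. \<exists>M (c :: nat \<Rightarrow> nat \<Rightarrow> nat \<Rightarrow> 'k). (\<exists>k\<le>N. \<exists>i<M. \<exists>j<M. c k i j \<noteq> 0) \<and>
     (\<Sum>k\<le>N. \<Sum>j<M. \<Sum>i<M. scalar (c k i j) * (g ^ i * f ^ j * n k)) = 0"
    using polynomials_dependent_over_two[of g f] by (elim exE)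
  note N = this[rule_format]
  have "\<exists>a. (\<forall>k\<le>N. \<forall>j. coeff (a k) j \<in> A) \<and> (\<exists>k\<le>N. a k \<noteq> 0) \<and>
     (\<Sum>k\<le>N. poly (a k) f * n k) = 0" for n :: "nat \<Rightarrow> 'k poly poly"
  proof -
    obtain M and c :: "nat \<Rightarrow> nat \<Rightarrow> nat \<Rightarrow> 'k" where "(\<exists>k\<le>N. \<exists>i<M. \<exists>j<M. c k i j \<noteq> 0) \<and>
      (\<Sum>k\<le>N. \<Sum>j<M. \<Sum>i<M. scalar (c k i j) * (g ^ i * f ^ j * n k)) = 0"
      using N[of n] by (elim exE)
    then have c: "\<exists>k\<le>N. \<exists>i<M. \<exists>j<M. c k i j \<noteq> 0"
      "(\<Sum>k\<le>N. \<Sum>j<M. \<Sum>i<M. scalar (c k i j) * (g ^ i * f ^ j * n k)) = 0"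
      by simp_all
    define p where "p k j = (\<Sum>i<M. monom (scalar (c k i j)) i)" for k j
    define a where "a k = (\<Sum>j<M. monom (poly (p k j) g) j)" for k
    have poly_p: "poly (p k j) g = (\<Sum>i<M. scalar (c k i j) * g ^ i)" for k j
      by (simp add: p_def poly_sum poly_monom)
    have pA: "poly (p k j) g \<in> A" for k j
      unfolding poly_p by (intro sum_mem mult_mem scalar_mem power_mem g)
    have coeff_a: "coeff (a k) j = (if j < M then poly (p k j) g else 0)" for k j
      by (simp add: a_def coeff_sum)
    have "\<exists>k\<le>N. a k \<noteq> 0"
    proof -
      from c(1) obtain k i j where k: "k \<le> N" "i < M" "j < M" "c k i j \<noteq> 0" by blast
      have coeff_p: "coeff (p k j) i' = (if i' < M then scalar (c k i' j) else 0)" for i'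
        by (simp add: p_def coeff_sum)
      then have "p k j \<noteq> 0" using k by (metis coeff_0 pCons_eq_0_iff)
      moreover have "coeff (p k j) i' \<in> range scalar" for i'
        using K.zero_mem by (simp add: coeff_p)
      ultimately have "poly (p k j) g \<noteq> 0" using K.outside_transcendental[OF g(2)] by blast
      then have "a k \<noteq> 0" using coeff_a[of k j] k by auto
      with k show ?thesis by blast
    qed
    moreover have "poly (a k) f * n k = (\<Sum>j<M. \<Sum>i<M. scalar (c k i j) * (g ^ i * f ^ j * n k))" for k
      by (simp add: a_def poly_sum poly_monom poly_p sum_distrib_left sum_distrib_right mult_ac)
    ultimately show ?thesis
      using c(2) pA zero_mem by (intro exI[of _ a]) (simp add: coeff_a)
  qed
  note dep = this
  show ?thesis by (rule exI[of _ N], rule allI, rule dep)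
qed

end

section \<open>Subrings of a field\<close>

locale field_subring =
  fixes S :: "'a::field set"
  assumes one_mem: "1 \<in> S"
    and diff_mem: "x \<in> S \<Longrightarrow> y \<in> S \<Longrightarrow> x - y \<in> S"
    and mult_mem: "x \<in> S \<Longrightarrow> y \<in> S \<Longrightarrow> x * y \<in> S"
begin

lemma zero_mem: "0 \<in> S"
  using diff_mem[OF one_mem one_mem] by simp

lemma uminus_mem: "x \<in> S \<Longrightarrow> - x \<in> S"
  using diff_mem[OF zero_mem] by simp

lemma add_mem: "x \<in> S \<Longrightarrow> y \<in> S \<Longrightarrow> x + y \<in> S"
  using diff_mem[of x "- y"] uminus_mem by simp

lemma power_mem: "x \<in> S \<Longrightarrow> x ^ n \<in> S"
  by (induction n) (auto intro: one_mem mult_mem)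

lemma sum_mem: "(\<And>i. i \<in> I \<Longrightarrow> h i \<in> S) \<Longrightarrow> (\<Sum>i\<in>I. h i) \<in> S"
  by (induction I rule: infinite_finite_induct) (auto intro: zero_mem add_mem)

text \<open>
  \<open>is_ideal\<close> and \<open>is_prime\<close> restate the notions for the ring with carrier \<open>S\<close> in terms of the
  operations of the ambient field; \<open>ideal_ring_on_iff\<close> and \<open>primeideal_ring_on_iff\<close> make the link.
\<close>

definition is_ideal :: "'a set \<Rightarrow> bool" where
  "is_ideal I \<longleftrightarrow> I \<subseteq> S \<and> 0 \<in> I \<and> (\<forall>x\<in>I. \<forall>y\<in>I. x + y \<in> I) \<and> (\<forall>x\<in>S. \<forall>y\<in>I. x * y \<in> I)"

definition is_prime :: "'a set \<Rightarrow> bool" where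
  "is_prime I \<longleftrightarrow> is_ideal I \<and> 1 \<notin> I \<and> (\<forall>x\<in>S. \<forall>y\<in>S. x * y \<in> I \<longrightarrow> x \<in> I \<or> y \<in> I)"

lemma ideal_subset: "is_ideal I \<Longrightarrow> x \<in> I \<Longrightarrow> x \<in> S"
  and ideal_zero: "is_ideal I \<Longrightarrow> 0 \<in> I"
  and ideal_add: "is_ideal I \<Longrightarrow> x \<in> I \<Longrightarrow> y \<in> I \<Longrightarrow> x + y \<in> I"
  and ideal_mult: "is_ideal I \<Longrightarrow> x \<in> S \<Longrightarrow> y \<in> I \<Longrightarrow> x * y \<in> I"
  by (auto simp: is_ideal_def)

lemma ideal_uminus: "is_ideal I \<Longrightarrow> x \<in> I \<Longrightarrow> - x \<in> I"
  using ideal_mult[of I "- 1" x] uminus_mem[OF one_mem] by simp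

lemma ideal_diff: "is_ideal I \<Longrightarrow> x \<in> I \<Longrightarrow> y \<in> I \<Longrightarrow> x - y \<in> I"
  using ideal_add[of I x "- y"] ideal_uminus by simp

lemma ideal_sum: "is_ideal I \<Longrightarrow> (\<And>i. i \<in> J \<Longrightarrow> h i \<in> I) \<Longrightarrow> (\<Sum>i\<in>J. h i) \<in> I"
  by (induction J rule: infinite_finite_induct) (auto intro: ideal_zero ideal_add)

lemma ideal_eq_carrier: "is_ideal I \<Longrightarrow> 1 \<in> I \<Longrightarrow> I = S"
  using ideal_mult[of I _ 1] ideal_subset by fastforce

lemma ideal_Int: "is_ideal I \<Longrightarrow> is_ideal J \<Longrightarrow> is_ideal (I \<inter> J)"
  by (auto simp: is_ideal_def)

lemma ideal_colon: "is_ideal I \<Longrightarrow> a \<in> S \<Longrightarrow> is_ideal {x \<in> S. a * x \<in> I}"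
  by (auto simp: is_ideal_def zero_mem add_mem mult_mem distrib_left mult.left_commute)

abbreviation "ring_on \<equiv> (ring_of_type_algebra :: 'a ring)\<lparr>carrier := S\<rparr>"

lemma domain_ring_on: "domain ring_on"
proof -
  have "\<exists>y\<in>S. x + y = 0" if "x \<in> S" for x
    using that uminus_mem by (intro bexI[of _ "- x"]) auto
  moreover have "\<exists>y\<in>S. y + x = 0" if "x \<in> S" for x
    using that uminus_mem by (intro bexI[of _ "- x"]) auto
  ultimately show ?thesis
    by unfold_locales
      (auto simp: ring_of_type_algebra_def Units_def zero_mem one_mem add_mem mult_mem
        algebra_simps add_eq_0_iff)
qed

sublocale R: domain ring_on
  by (rule domain_ring_on)

lemma ideal_ring_on_iff: "ideal I ring_on \<longleftrightarrow> is_ideal I"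
proof
  assume "ideal I ring_on"
  then interpret I: ideal I ring_on .
  show "is_ideal I"
    using I.Icarr I.zero_closed I.a_closed I.I_l_closed
    by (auto simp: is_ideal_def ring_of_type_algebra_def)
next
  assume I: "is_ideal I"
  have "subgroup I (add_monoid ring_on)"
  proof (rule R.add.subgroupI)
    fix a assume a: "a \<in> I"
    have "a \<in> S" using a I ideal_subset by blast
    then have "\<ominus>\<^bsub>ring_on\<^esub> a = - a"
      using uminus_mem
      by (intro R.minus_equality) (auto simp: ring_of_type_algebra_def)
    then show "\<ominus>\<^bsub>ring_on\<^esub> a \<in> I" using ideal_uminus[OF I a] by simp
  qed (use I in \<open>auto simp: is_ideal_def ring_of_type_algebra_def\<close>)
  moreover have "x * a \<in> I" "a * x \<in> I" if "a \<in> I" "x \<in> S" for a x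
    using ideal_mult[OF I that(2,1)] by (simp_all add: mult.commute)
  ultimately show "ideal I ring_on"
    by (intro idealI[OF R.ring_axioms]) (auto simp: ring_of_type_algebra_def)
qed

lemma primeideal_ring_on_iff: "primeideal I ring_on \<longleftrightarrow> is_prime I"
proof
  assume "primeideal I ring_on"
  then interpret I: primeideal I ring_on .
  have I: "is_ideal I" using I.is_ideal by (simp only: ideal_ring_on_iff)
  moreover have "1 \<notin> I"
    using ideal_eq_carrier[OF I] I.I_notcarr by auto
  ultimately show "is_prime I"
    using I.I_prime by (auto simp: is_prime_def ring_of_type_algebra_def)
next
  assume I: "is_prime I"
  then have "ideal I ring_on" by (simp only: ideal_ring_on_iff is_prime_def)
  moreover have "S \<noteq> I" using I one_mem by (auto simp: is_prime_def)
  ultimately show "primeideal I ring_on"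
    using I by (intro primeidealI R.is_cring) (auto simp: is_prime_def ring_of_type_algebra_def)
qed

text \<open>
  Generation is expressed by minimality among the ideals containing \<open>T\<close>; linear combinations never
  have to be written down.
\<close>

definition finitely_generated :: "'a set \<Rightarrow> bool" where
  "finitely_generated I \<longleftrightarrow>
     (\<exists>T\<subseteq>I. finite T \<and> (\<forall>J. is_ideal J \<longrightarrow> T \<subseteq> J \<longrightarrow> I \<subseteq> J))"

lemma noetherian_ring_onI:
  assumes "\<And>I. is_ideal I \<Longrightarrow> finitely_generated I"
  shows "noetherian_domain ring_on"
proof -
  have "\<exists>T\<subseteq>carrier ring_on. finite T \<and> I = genideal ring_on T" if "ideal I ring_on" for I
  proof -
    have I: "is_ideal I" using that by (simp only: ideal_ring_on_iff)
    then obtain T where T: "T \<subseteq> I" "finite T" "\<And>J. is_ideal J \<Longrightarrow> T \<subseteq> J \<Longrightarrow> I \<subseteq> J"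
      using assms[OF I] by (auto simp: finitely_generated_def)
    have "I = genideal ring_on T"
      unfolding genideal_def ideal_ring_on_iff using T I by blast
    moreover have "T \<subseteq> carrier ring_on" using T(1) I ideal_subset by auto
    ultimately show ?thesis using T(2) by blast
  qed
  then show ?thesis by unfold_locales blast
qed

end

section \<open>Finiteness of the localization\<close>

lemma fract_obtain:
  fixes x :: "'a::idom fract"
  obtains n d where "d \<noteq> 0" "x = to_fract n / to_fract d"
  by (cases x) (auto simp: Fract_conv_to_fract)

lemma common_denominator:
  fixes s :: "nat \<Rightarrow> 'a::idom fract"
  shows "\<exists>d n. d \<noteq> 0 \<and> (\<forall>k\<le>N. s k * to_fract d = to_fract (n k))"
proof (induction N)
  case 0
  obtain n d where "d \<noteq> 0" "s 0 = to_fract n / to_fract d" by (rule fract_obtain)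
  then show ?case by (intro exI[of _ d] exI[of _ "\<lambda>_. n"]) simp
next
  case (Suc N)
  then obtain d n where dn: "d \<noteq> 0" "\<forall>k\<le>N. s k * to_fract d = to_fract (n k)" by (elim exE conjE)
  obtain n' d' where n': "d' \<noteq> 0" "s (Suc N) = to_fract n' / to_fract d'" by (rule fract_obtain)
  have "s k * to_fract (d * d') = to_fract (if k = Suc N then n' * d else n k * d')"
    if "k \<le> Suc N" for k
  proof (cases "k = Suc N")
    case False
    then have "s k * to_fract d = to_fract (n k)" using dn(2) that by auto
    then show ?thesis using False by (simp flip: mult.assoc)
  qed (use n' in simp)
  then show ?case using dn(1) n'(1)
    by (intro exI[of _ "d * d'"] exI[of _ "\<lambda>k. if k = Suc N then n' * d else n k * d'"]) simp
qed

text \<open>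
  The situation in which the argument of Krull and Akizuki is carried out: \<open>S\<close> is a ring between the
  reciprocal complement and the fraction field in which the nonzero elements of \<open>A\<close> are units. The
  role of the base ring is played by the polynomials in 1/f over the fraction field of \<open>A\<close>. The element \<open>g\<close> witnesses that \<open>A\<close> is larger than the field of constants,
  which cuts the transcendence degree of the fraction field over \<open>A\<close> down to one.
\<close>

locale reciprocal_localization = field_subring S + A: factorially_closed A
  for S :: "'k::field poly poly fract set" and A :: "'k poly poly set" +
  fixes f g
  assumes recip: "h \<noteq> 0 \<Longrightarrow> 1 / to_fract h \<in> S"
    and A_sub: "a \<in> A \<Longrightarrow> to_fract a \<in> S"
    and f: "f \<notin> A"
    and g: "g \<in> A" "g \<notin> range scalar"
begin

definition \<pi> :: "'k poly poly fract" where "\<pi> = 1 / to_fract f"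

lemma f_nonzero: "f \<noteq> 0"
  using f A.zero_mem by auto

lemma pi_S: "\<pi> \<in> S"
  using recip[OF f_nonzero] by (simp add: \<pi>_def)

text \<open>
  Division by the power of f belonging to the degree bound turns a polynomial in f into a
  polynomial in \<open>\<pi>\<close> whose constant term is the leading coefficient.
\<close>

lemma poly_leading_expansion:
  assumes "\<And>j. coeff p j \<in> A" "degree p \<le> J"
  shows "\<exists>u\<in>S. to_fract (poly p f) / to_fract f ^ J = to_fract (coeff p J) + \<pi> * u"
  using assms
proof (induction p arbitrary: J)
  case 0
  then show ?case using zero_mem by (intro bexI[of _ 0]) auto
next
  case (pCons a p)
  have f0: "to_fract f \<noteq> 0" using f_nonzero by simp
  show ?case
  proof (cases J)
    case 0
    then have "p = 0" using pCons.prems(2) by (auto split: if_splits)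
    then show ?thesis using 0 zero_mem by (intro bexI[of _ 0]) auto
  next
    case (Suc J')
    have "coeff p j \<in> A" for j using pCons.prems(1)[of "Suc j"] by simp
    moreover have "degree p \<le> J'" using pCons.prems(2) Suc by (auto split: if_splits)
    ultimately obtain u where u: "u \<in> S"
      "to_fract (poly p f) / to_fract f ^ J' = to_fract (coeff p J') + \<pi> * u"
      using pCons.IH by blast
    have "a \<in> A" using pCons.prems(1)[of 0] by simp
    then have "u + to_fract a * \<pi> ^ J' \<in> S"
      by (intro add_mem mult_mem power_mem pi_S A_sub u)
    moreover have "to_fract (poly (pCons a p) f) / to_fract f ^ J =
        to_fract a * \<pi> ^ J + to_fract (poly p f) / to_fract f ^ J'"
      using f0 Suc by (simp add: \<pi>_def field_simps power_divide)
    ultimately show ?thesis using u(2) Suc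
      by (intro bexI[of _ "u + to_fract a * \<pi> ^ J'"]) (simp_all add: algebra_simps)
  qed
qed

lemma uniform_dependence:
  "\<exists>N::nat. \<forall>n :: nat \<Rightarrow> 'k poly poly. \<exists>a. (\<forall>k\<le>N. \<forall>j. coeff (a k) j \<in> A) \<and> (\<exists>k\<le>N. a k \<noteq> 0) \<and>
     (\<Sum>k\<le>N. poly (a k) f * n k) = 0"
  by (rule A.dependent_over_polynomials_in[OF g])

text \<open>
  This says that \<open>S/\<pi>S\<close> has dimension at most \<open>N\<close> over the fraction field of \<open>A\<close>, denominators
  being cleared from the coefficients.
\<close>

lemma dependent_mod_pi:
  "\<exists>N::nat. \<forall>s. (\<forall>k\<le>N. s k \<in> S) \<longrightarrow> (\<exists>b. (\<forall>k\<le>N. b k \<in> A) \<and> (\<exists>k\<le>N. b k \<noteq> 0) \<and>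
     (\<exists>u\<in>S. (\<Sum>k\<le>N. to_fract (b k) * s k) = \<pi> * u))"
proof -
  obtain N where N: "\<forall>n :: nat \<Rightarrow> 'k poly poly. \<exists>a. (\<forall>k\<le>N. \<forall>j. coeff (a k) j \<in> A) \<and>
     (\<exists>k\<le>N. a k \<noteq> 0) \<and> (\<Sum>k\<le>N. poly (a k) f * n k) = 0"
    using uniform_dependence by (elim exE)
  have "\<exists>b. (\<forall>k\<le>N. b k \<in> A) \<and> (\<exists>k\<le>N. b k \<noteq> 0) \<and>
     (\<exists>u\<in>S. (\<Sum>k\<le>N. to_fract (b k) * s k) = \<pi> * u)" if s: "\<forall>k\<le>N. s k \<in> S" for s
  proof -
    obtain d n where d: "d \<noteq> 0" and n: "\<forall>k\<le>N. s k * to_fract d = to_fract (n k)"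
      using common_denominator[of N s] by (elim exE conjE)
    obtain a where "(\<forall>k\<le>N. \<forall>j. coeff (a k) j \<in> A) \<and>
      (\<exists>k\<le>N. a k \<noteq> 0) \<and> (\<Sum>k\<le>N. poly (a k) f * n k) = 0"
      using N[rule_format, of n] by (elim exE)
    then have a: "\<And>k j. k \<le> N \<Longrightarrow> coeff (a k) j \<in> A" "\<exists>k\<le>N. a k \<noteq> 0"
      "(\<Sum>k\<le>N. poly (a k) f * n k) = 0" by simp_all
    define K where "K = {k. k \<le> N \<and> a k \<noteq> 0}"
    \<comment> \<open>the largest degree, so that the coefficients \<open>b k\<close> taken at \<open>J\<close> are not all zero\<close>
    define J where "J = Max ((\<lambda>k. degree (a k)) ` K)"
    have K: "finite K" "K \<noteq> {}" using a(2) by (auto simp: K_def)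
    have deg: "degree (a k) \<le> J" if "k \<le> N" for k
    proof (cases "a k = 0")
      case False
      then show ?thesis using that K(1) by (auto simp: J_def K_def intro!: Max_ge)
    qed simp
    have "J \<in> (\<lambda>k. degree (a k)) ` K" unfolding J_def using K by (intro Max_in) auto
    then obtain k0 where k0: "k0 \<le> N" "a k0 \<noteq> 0" "J = degree (a k0)" by (auto simp: K_def)
    define b where "b k = coeff (a k) J" for k
    have "\<forall>k\<in>{..N}. \<exists>u\<in>S. to_fract (poly (a k) f) / to_fract f ^ J = to_fract (b k) + \<pi> * u"
      unfolding b_def using poly_leading_expansion[OF a(1) deg] by blast
    then obtain u where u: "\<And>k. k \<le> N \<Longrightarrow> u k \<in> S"
      "\<And>k. k \<le> N \<Longrightarrow> to_fract (poly (a k) f) / to_fract f ^ J = to_fract (b k) + \<pi> * u k"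
      by (metis atMost_iff)
    have "(\<Sum>k\<le>N. (to_fract (b k) + \<pi> * u k) * s k) * (to_fract d * to_fract f ^ J)
       = (\<Sum>k\<le>N. to_fract (poly (a k) f) * to_fract (n k))"
      unfolding sum_distrib_right
    proof (intro sum.cong refl)
      fix k assume "k \<in> {..N}"
      then have k: "k \<le> N" by simp
      have "to_fract (poly (a k) f) * to_fract (n k) =
        to_fract (poly (a k) f) / to_fract f ^ J * to_fract f ^ J * (s k * to_fract d)"
        using n k f_nonzero by simp
      then show "(to_fract (b k) + \<pi> * u k) * s k * (to_fract d * to_fract f ^ J) =
          to_fract (poly (a k) f) * to_fract (n k)"
        unfolding u(2)[OF k] by (simp only: mult_ac)
    qed
    also have "\<dots> = to_fract (\<Sum>k\<le>N. poly (a k) f * n k)" by simp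
    also have "\<dots> = 0" using a(3) by simp
    finally have "(\<Sum>k\<le>N. (to_fract (b k) + \<pi> * u k) * s k) = 0" using d f_nonzero by simp
    then have "(\<Sum>k\<le>N. to_fract (b k) * s k) = \<pi> * (\<Sum>k\<le>N. - u k * s k)"
      by (simp add: distrib_right sum.distrib sum_distrib_left sum_negf mult.assoc
          eq_neg_iff_add_eq_0)
    moreover have "(\<Sum>k\<le>N. - u k * s k) \<in> S"
      using u(1) s by (intro sum_mem mult_mem uminus_mem) auto
    moreover have "\<exists>k\<le>N. b k \<noteq> 0" using k0 by (auto simp: b_def)
    moreover have "\<forall>k\<le>N. b k \<in> A" using a(1) by (simp add: b_def)
    ultimately show ?thesis by blast
  qed
  then show ?thesis by blast
qed

text \<open>
  A family in \<open>I\<close> that is independent modulo \<open>\<pi>\<close> has bounded length by \<open>dependent_mod_pi\<close>, and a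
  family which cannot be prolonged spans \<open>I\<close> modulo \<open>\<pi> S\<close>. The conclusion is phrased for an arbitrary
  ideal \<open>J\<close> containing the family to avoid linear combinations.
\<close>

lemma ideal_generated_mod_pi:
  assumes I: "is_ideal I"
  shows "\<exists>T\<subseteq>I. finite T \<and>
     (\<forall>J s. is_ideal J \<longrightarrow> T \<subseteq> J \<longrightarrow> s \<in> I \<longrightarrow> (\<exists>j\<in>J. \<exists>u\<in>S. s = j + \<pi> * u))"
proof -
  define dep where "dep s m \<longleftrightarrow> (\<exists>b. \<exists>u\<in>S. (\<forall>k<m. b k \<in> A) \<and> (\<exists>k<m. b k \<noteq> 0) \<and>
     (\<Sum>k<m. to_fract (b k) * s k) = \<pi> * u)" for s :: "nat \<Rightarrow> 'k poly poly fract" and m :: nat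
  define P where "P m \<longleftrightarrow> (\<exists>s. (\<forall>k<m. s k \<in> I) \<and> \<not> dep s m)" for m
  obtain N :: nat where "\<forall>s. (\<forall>k\<le>N. s k \<in> S) \<longrightarrow> (\<exists>b. (\<forall>k\<le>N. b k \<in> A) \<and> (\<exists>k\<le>N. b k \<noteq> 0) \<and>
     (\<exists>u\<in>S. (\<Sum>k\<le>N. to_fract (b k) * s k) = \<pi> * u))"
    using dependent_mod_pi by (elim exE)
  note N = this[THEN spec, THEN mp]
  have "dep s (Suc N)" if "\<forall>k<Suc N. s k \<in> I" for s
  proof -
    have "\<forall>k\<le>N. s k \<in> S" using that I ideal_subset by (auto simp: less_Suc_eq_le)
    from N[OF this] obtain b where b: "(\<forall>k\<le>N. b k \<in> A) \<and> (\<exists>k\<le>N. b k \<noteq> 0) \<and>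
     (\<exists>u\<in>S. (\<Sum>k\<le>N. to_fract (b k) * s k) = \<pi> * u)" by (elim exE)
    then show ?thesis
      unfolding dep_def less_Suc_eq_le lessThan_Suc_atMost by (intro exI[of _ b]) simp
  qed
  then have "\<not> P (Suc N)" by (auto simp: P_def)
  then have notall: "\<not> (\<forall>m. P m)" by (elim contrapos_nn allE)
  have base: "P 0" by (auto simp: P_def dep_def)
  obtain m where m: "P m" "\<not> P (Suc m)"
    using notall base nat_induct[of P] by blast
  then obtain s where s: "\<forall>k<m. s k \<in> I" "\<not> dep s m" by (auto simp: P_def)
  have sI: "s k \<in> I" if "k < m" for k using s(1) that by simp
  define T where "T = s ` {..<m}"
  have "\<exists>j\<in>J. \<exists>u\<in>S. x = j + \<pi> * u" if J: "is_ideal J" "T \<subseteq> J" "x \<in> I" for J x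
  proof -
    define s' where "s' = s(m := x)"
    have "\<forall>k<Suc m. s' k \<in> I" using sI that by (auto simp: s'_def less_Suc_eq)
    then have "dep s' (Suc m)" using m(2) unfolding P_def by blast
    then obtain b u where u: "u \<in> S" and "(\<forall>k<Suc m. b k \<in> A) \<and> (\<exists>k<Suc m. b k \<noteq> 0) \<and>
     (\<Sum>k<Suc m. to_fract (b k) * s' k) = \<pi> * u"
      unfolding dep_def by (elim exE bexE)
    then have b: "\<And>k. k < Suc m \<Longrightarrow> b k \<in> A" and nz: "\<exists>k<Suc m. b k \<noteq> 0"
      and eq: "(\<Sum>k<Suc m. to_fract (b k) * s' k) = \<pi> * u"
      by simp_all
    have "(\<Sum>k<m. to_fract (b k) * s' k) = (\<Sum>k<m. to_fract (b k) * s k)"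
      by (intro sum.cong) (auto simp: s'_def)
    then have eq': "(\<Sum>k<m. to_fract (b k) * s k) + to_fract (b m) * x = \<pi> * u"
      using eq by (simp add: s'_def)
    have bm: "b m \<noteq> 0"
    proof
      assume b0: "b m = 0"
      then have "\<exists>k<m. b k \<noteq> 0" using nz by (auto simp: less_Suc_eq)
      then have "dep s m" unfolding dep_def
        using b u eq' b0 by (intro exI[of _ b] bexI[of _ u]) auto
      with s(2) show False by simp
    qed
    define j where "j = - (1 / to_fract (b m) * (\<Sum>k<m. to_fract (b k) * s k))"
    have "j \<in> J" unfolding j_def
      using J(2) b
      by (intro ideal_uminus ideal_mult ideal_sum J(1) recip[OF bm] A_sub) (auto simp: T_def)
    moreover have "1 / to_fract (b m) * u \<in> S" by (intro mult_mem recip bm u)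
    moreover have "x = j + \<pi> * (1 / to_fract (b m) * u)"
    proof -
      have "to_fract (b m) * x = \<pi> * u - (\<Sum>k<m. to_fract (b k) * s k)"
        using eq' by (simp add: algebra_simps)
      then show ?thesis using bm by (simp add: j_def field_simps)
    qed
    ultimately show ?thesis by blast
  qed
  moreover have "T \<subseteq> I" "finite T" using sI by (auto simp: T_def)
  ultimately show ?thesis by blast
qed

text \<open>
  The part of \<open>I\<close> in \<open>\<pi> S\<close> is \<open>\<pi> I0\<close> for the ideal \<open>I0\<close> of all x with \<open>\<pi> x \<in> I\<close>, and \<open>I0\<close> contains a
  smaller power of \<open>\<pi>\<close>. So \<open>I\<close> is generated by \<open>\<pi>\<close> times the generators of \<open>I0\<close> and by elements that
  generate it modulo \<open>\<pi>\<close>.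
\<close>

lemma ideal_with_pi_power_fg:
  assumes "is_ideal I" "\<pi> ^ e \<in> I"
  shows "finitely_generated I"
  using assms
proof (induction e arbitrary: I)
  case 0
  then have "{1} \<subseteq> I" by simp
  moreover have "I \<subseteq> J" if "is_ideal J" "{1} \<subseteq> J" for J
    using that ideal_eq_carrier[of J] ideal_subset[OF 0(1)] by auto
  ultimately show ?case unfolding finitely_generated_def by (intro exI[of _ "{1}"]) blast
next
  case (Suc e)
  note I = Suc.prems(1)
  define I0 where "I0 = {x \<in> S. \<pi> * x \<in> I}"
  have "is_ideal I0" unfolding I0_def by (intro ideal_colon I pi_S)
  moreover have "\<pi> ^ e \<in> I0" using Suc.prems(2) by (simp add: I0_def power_mem pi_S)
  ultimately have "finitely_generated I0" by (rule Suc.IH)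
  then obtain T0 where T0: "T0 \<subseteq> I0" "finite T0" "\<And>J. is_ideal J \<Longrightarrow> T0 \<subseteq> J \<Longrightarrow> I0 \<subseteq> J"
    unfolding finitely_generated_def by blast
  obtain T1 where T1: "T1 \<subseteq> I" "finite T1"
    "\<And>J s. is_ideal J \<Longrightarrow> T1 \<subseteq> J \<Longrightarrow> s \<in> I \<Longrightarrow> \<exists>j\<in>J. \<exists>u\<in>S. s = j + \<pi> * u"
    using ideal_generated_mod_pi[OF I] by blast
  define T where "T = T1 \<union> (\<lambda>x. \<pi> * x) ` T0"
  have "T \<subseteq> I" using T0(1) T1(1) by (auto simp: T_def I0_def)
  moreover have "finite T" using T0(2) T1(2) by (simp add: T_def)
  moreover have "I \<subseteq> J" if J: "is_ideal J" "T \<subseteq> J" for J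
  proof
    fix x assume x: "x \<in> I"
    \<comment> \<open>intersecting with \<open>I\<close> ensures that the remainder \<open>\<pi> * u\<close> is again in \<open>I\<close>\<close>
    have "T1 \<subseteq> J \<inter> I" using J(2) T1(1) by (auto simp: T_def)
    then obtain j u where ju: "j \<in> J" "j \<in> I" "u \<in> S" "x = j + \<pi> * u"
      using T1(3)[OF ideal_Int[OF J(1) I] _ x] by blast
    then have "\<pi> * u \<in> I" using ideal_diff[OF I x ju(2)] by simp
    then have "u \<in> I0" using ju(3) by (simp add: I0_def)
    moreover have "I0 \<subseteq> {y \<in> S. \<pi> * y \<in> J}"
    proof (rule T0(3))
      show "is_ideal {y \<in> S. \<pi> * y \<in> J}" by (intro ideal_colon J(1) pi_S)
      show "T0 \<subseteq> {y \<in> S. \<pi> * y \<in> J}" using T0(1) J(2) by (auto simp: T_def I0_def)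
    qed
    ultimately have "\<pi> * u \<in> J" by blast
    then show "x \<in> J" using ideal_add[OF J(1) ju(1)] ju(4) by simp
  qed
  ultimately show ?case unfolding finitely_generated_def by blast
qed

text \<open>
  The powers of a denominator \<open>F\<close> satisfy a relation over \<open>A[f]\<close>. Cancelling the lowest power of \<open>F\<close>
  in it shows that \<open>F\<close> divides a nonzero polynomial w in \<open>f\<close> with coefficients in \<open>A\<close>. Then 1/w is in
  the ideal along with 1/F, and w divided by a power of \<open>f\<close> is in \<open>S\<close>.
\<close>

lemma nonzero_ideal_contains_pi_power:
  assumes I: "is_ideal I" and x: "x \<in> I" "x \<noteq> 0"
  shows "\<exists>e. \<pi> ^ e \<in> I"
proof -
  obtain n F where F: "F \<noteq> 0" "x = to_fract n / to_fract F" by (rule fract_obtain)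
  with x have "n \<noteq> 0" by auto
  then have "1 / to_fract n * x \<in> I" by (intro ideal_mult I recip x)
  then have FI: "1 / to_fract F \<in> I" using F \<open>n \<noteq> 0\<close> by simp
  obtain N where N: "\<forall>n :: nat \<Rightarrow> 'k poly poly. \<exists>a. (\<forall>k\<le>N. \<forall>j. coeff (a k) j \<in> A) \<and>
     (\<exists>k\<le>N. a k \<noteq> 0) \<and> (\<Sum>k\<le>N. poly (a k) f * n k) = 0"
    using uniform_dependence by (elim exE)
  obtain a where "(\<forall>k\<le>N. \<forall>j. coeff (a k) j \<in> A) \<and>
      (\<exists>k\<le>N. a k \<noteq> 0) \<and> (\<Sum>k\<le>N. poly (a k) f * F ^ k) = 0"
    using N[rule_format, of "\<lambda>k. F ^ k"] by (elim exE)
  then have a: "\<And>k j. k \<le> N \<Longrightarrow> coeff (a k) j \<in> A" "\<exists>k\<le>N. a k \<noteq> 0"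
      "(\<Sum>k\<le>N. poly (a k) f * F ^ k) = 0" by simp_all
  define k where "k = (LEAST k. k \<le> N \<and> a k \<noteq> 0)"
  have k: "k \<le> N" "a k \<noteq> 0" using LeastI_ex[OF a(2)] by (simp_all add: k_def)
  have below: "a i = 0" if "i < k" for i
    using not_less_Least[of i "\<lambda>k. k \<le> N \<and> a k \<noteq> 0"] that k(1) by (auto simp: k_def)
  define w where "w = poly (a k) f"
  have w0: "w \<noteq> 0"
    unfolding w_def using A.outside_transcendental[OF f a(1)[OF k(1)]] k(2) by blast
  have "w * F ^ k + (\<Sum>i\<in>{..N}-{k}. poly (a i) f * F ^ i) = 0"
    using k(1) a(3) by (simp add: w_def sum.remove)
  then have "w * F ^ k = - (\<Sum>i\<in>{..N}-{k}. poly (a i) f * F ^ i)"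
    by (simp only: eq_neg_iff_add_eq_0)
  moreover have "F ^ Suc k dvd (\<Sum>i\<in>{..N}-{k}. poly (a i) f * F ^ i)"
  proof (rule dvd_sum)
    fix i assume i: "i \<in> {..N} - {k}"
    show "F ^ Suc k dvd poly (a i) f * F ^ i"
    proof (cases "i < k")
      case False
      then have "Suc k \<le> i" using i by simp
      then show ?thesis by (intro dvd_mult le_imp_power_dvd)
    qed (simp add: below)
  qed
  ultimately have "F ^ Suc k dvd w * F ^ k"
    by (simp only: dvd_minus_iff)
  then have "F dvd w" using F(1) by simp
  then obtain G where G: "w = F * G" by (elim dvdE)
  then have "G \<noteq> 0" using w0 by auto
  then have "1 / to_fract G * (1 / to_fract F) \<in> I" by (intro ideal_mult I recip FI)
  then have wI: "1 / to_fract w \<in> I" using G by (simp add: mult.commute)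
  define e where "e = degree (a k)"
  obtain u where u: "u \<in> S" "to_fract w / to_fract f ^ e = to_fract (coeff (a k) e) + \<pi> * u"
    unfolding w_def e_def using poly_leading_expansion[OF a(1)[OF k(1)] order_refl] by blast
  have "to_fract w / to_fract f ^ e \<in> S"
    unfolding u(2) by (intro add_mem mult_mem pi_S u(1) A_sub a(1) k(1))
  then have "to_fract w / to_fract f ^ e * (1 / to_fract w) \<in> I" by (intro ideal_mult I wI)
  then have "\<pi> ^ e \<in> I" using w0 by (simp add: \<pi>_def power_divide)
  then show ?thesis by blast
qed

theorem noetherian: "noetherian_domain ring_on"
proof (rule noetherian_ring_onI)
  fix I assume I: "is_ideal I"
  show "finitely_generated I"
  proof (cases "I = {0}")
    case True
    then show ?thesis unfolding finitely_generated_def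
      by (intro exI[of _ "{}"]) (auto simp: is_ideal_def)
  next
    case False
    then obtain x where "x \<in> I" "x \<noteq> 0" using ideal_zero[OF I] by auto
    then obtain e where "\<pi> ^ e \<in> I" using nonzero_ideal_contains_pi_power[OF I] by blast
    then show ?thesis by (rule ideal_with_pi_power_fg[OF I])
  qed
qed

end

section \<open>The degree valuation and its lexicographic refinement\<close>

lemma coeff_mult_at_degree_bounds:
  fixes p q :: "'a::comm_semiring_0 poly"
  assumes "degree p \<le> m" "degree q \<le> n"
  shows "coeff (p * q) (m + n) = coeff p m * coeff q n"
proof (cases "degree p = m \<and> degree q = n")
  case True
  then show ?thesis using coeff_mult_degree_sum by blast
next
  case False
  then have "degree p + degree q < m + n" using assms by linarith
  then have "degree (p * q) < m + n" using degree_mult_le[of p q] by linarith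
  moreover have "coeff p m = 0 \<or> coeff q n = 0" using False assms by (auto simp: coeff_eq_0)
  ultimately show ?thesis by (auto simp: coeff_eq_0)
qed

text \<open>
  For nonzero \<open>n\<close> this says that the pair (degree in Y, degree in X of the leading coefficient) of
  \<open>n\<close> is lexicographically smaller than that of \<open>d\<close>. Looking at the coefficient of \<open>n\<close> at the
  degree of \<open>d\<close> instead of comparing two leading coefficients makes the condition visibly additive
  in \<open>n\<close>.
\<close>

definition lex_smaller :: "'k::field poly poly \<Rightarrow> 'k poly poly \<Rightarrow> bool" where
  "lex_smaller n d \<longleftrightarrow> degree n \<le> degree d \<and>
     (coeff n (degree d) = 0 \<or> degree (coeff n (degree d)) < degree (lead_coeff d))"

lemma lex_smaller_mult:
  assumes "lex_smaller n d" "lex_smaller n' d'" "d \<noteq> 0" "d' \<noteq> 0"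
  shows "lex_smaller (n * n') (d * d')"
proof -
  have deg: "degree n \<le> degree d" "degree n' \<le> degree d'" using assms by (auto simp: lex_smaller_def)
  have dd: "degree (d * d') = degree d + degree d'" using assms by (simp add: degree_mult_eq)
  have "degree (n * n') \<le> degree (d * d')"
    using degree_mult_le[of n n'] deg dd by linarith
  moreover have top: "coeff (n * n') (degree (d * d')) = coeff n (degree d) * coeff n' (degree d')"
    unfolding dd by (rule coeff_mult_at_degree_bounds[OF deg])
  moreover have "degree (coeff n (degree d) * coeff n' (degree d')) < degree (lead_coeff (d * d'))"
    if "coeff n (degree d) \<noteq> 0" "coeff n' (degree d') \<noteq> 0"
  proof -
    have "degree (coeff n (degree d)) < degree (lead_coeff d)"
      "degree (coeff n' (degree d')) < degree (lead_coeff d')"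
      using assms that by (auto simp: lex_smaller_def)
    moreover have "degree (lead_coeff (d * d')) = degree (lead_coeff d) + degree (lead_coeff d')"
      unfolding lead_coeff_mult using assms by (intro degree_mult_eq) auto
    moreover have "degree (coeff n (degree d) * coeff n' (degree d')) =
        degree (coeff n (degree d)) + degree (coeff n' (degree d'))"
      using that by (intro degree_mult_eq)
    ultimately show ?thesis by linarith
  qed
  ultimately show ?thesis unfolding lex_smaller_def by auto
qed

lemma lex_smaller_mult_common:
  assumes "lex_smaller n d" "d \<noteq> 0" "e \<noteq> 0"
  shows "lex_smaller (n * e) (d * e)"
proof -
  have deg: "degree n \<le> degree d" using assms by (auto simp: lex_smaller_def)
  have dd: "degree (d * e) = degree d + degree e" using assms by (simp add: degree_mult_eq)
  have "degree (n * e) \<le> degree (d * e)"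
    using degree_mult_le[of n e] deg dd by linarith
  moreover have "coeff (n * e) (degree (d * e)) = coeff n (degree d) * lead_coeff e"
    unfolding dd by (rule coeff_mult_at_degree_bounds[OF deg order_refl])
  moreover have "degree (coeff n (degree d) * lead_coeff e) < degree (lead_coeff (d * e))"
    if "coeff n (degree d) \<noteq> 0"
  proof -
    have "degree (coeff n (degree d)) < degree (lead_coeff d)"
      using assms that by (auto simp: lex_smaller_def)
    moreover have "degree (lead_coeff (d * e)) = degree (lead_coeff d) + degree (lead_coeff e)"
      unfolding lead_coeff_mult using assms by (intro degree_mult_eq) auto
    moreover have "degree (coeff n (degree d) * lead_coeff e) =
        degree (coeff n (degree d)) + degree (lead_coeff e)"
      using that assms by (intro degree_mult_eq) auto
    ultimately show ?thesis by linarith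
  qed
  ultimately show ?thesis unfolding lex_smaller_def by auto
qed

lemma lex_smaller_add:
  assumes "lex_smaller n d" "lex_smaller n' d"
  shows "lex_smaller (n + n') d"
proof -
  have "degree (n + n') \<le> degree d"
    using assms by (intro degree_add_le) (auto simp: lex_smaller_def)
  moreover have "degree (coeff n (degree d) + coeff n' (degree d)) < degree (lead_coeff d)"
    if "coeff n (degree d) + coeff n' (degree d) \<noteq> 0"
  proof -
    consider "coeff n (degree d) = 0" | "coeff n' (degree d) = 0"
      | "coeff n (degree d) \<noteq> 0" "coeff n' (degree d) \<noteq> 0" by blast
    then show ?thesis using assms that
      by cases (auto simp: lex_smaller_def intro: degree_add_less)
  qed
  ultimately show ?thesis unfolding lex_smaller_def by auto
qed

lemma lex_smaller_scalar_mult: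
  assumes "lex_smaller n d"
  shows "lex_smaller (scalar c * n) d"
  using assms degree_smult_le[of "[:c:]" n] degree_smult_le[of c "coeff n (degree d)"]
  by (auto simp: lex_smaller_def)

text \<open>
  The maximal ideal of the valuation ring, of rank two, that belongs to this order.
\<close>

definition infinitesimals :: "'k::field poly poly fract set" where
  "infinitesimals = {to_fract n / to_fract d | n d. d \<noteq> 0 \<and> lex_smaller n d}"

lemma infinitesimalsI: "d \<noteq> 0 \<Longrightarrow> lex_smaller n d \<Longrightarrow> to_fract n / to_fract d \<in> infinitesimals"
  unfolding infinitesimals_def by blast

lemma infinitesimals_add:
  assumes "x \<in> infinitesimals" "y \<in> infinitesimals"
  shows "x + y \<in> infinitesimals"
proof -
  obtain n d n' d' where n: "d \<noteq> 0" "lex_smaller n d" "x = to_fract n / to_fract d"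
    "d' \<noteq> 0" "lex_smaller n' d'" "y = to_fract n' / to_fract d'"
    using assms by (auto simp: infinitesimals_def)
  have "lex_smaller (n * d' + n' * d) (d * d')"
    using lex_smaller_mult_common[of n d d'] lex_smaller_mult_common[of n' d' d] n
    by (intro lex_smaller_add) (simp_all add: mult.commute)
  moreover have "x + y = to_fract (n * d' + n' * d) / to_fract (d * d')"
    using n by (simp add: field_simps)
  moreover have "d * d' \<noteq> 0" using n by simp
  ultimately show ?thesis using infinitesimalsI by metis
qed

lemma infinitesimals_mult:
  assumes "x \<in> infinitesimals" "y \<in> infinitesimals"
  shows "x * y \<in> infinitesimals"
proof -
  obtain n d n' d' where n: "d \<noteq> 0" "lex_smaller n d" "x = to_fract n / to_fract d"
    "d' \<noteq> 0" "lex_smaller n' d'" "y = to_fract n' / to_fract d'"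
    using assms by (auto simp: infinitesimals_def)
  then have "x * y = to_fract (n * n') / to_fract (d * d')" by simp
  moreover have "d * d' \<noteq> 0" using n by simp
  moreover have "lex_smaller (n * n') (d * d')" using n by (intro lex_smaller_mult)
  ultimately show ?thesis using infinitesimalsI by metis
qed

lemma infinitesimals_scalar_mult:
  assumes "x \<in> infinitesimals"
  shows "to_fract (scalar c) * x \<in> infinitesimals"
proof -
  obtain n d where n: "d \<noteq> 0" "lex_smaller n d" "x = to_fract n / to_fract d"
    using assms by (auto simp: infinitesimals_def)
  then have "to_fract (scalar c) * x = to_fract (scalar c * n) / to_fract d"
    by (simp only: to_fract_mult times_divide_eq_right)
  then show ?thesis using infinitesimalsI[OF n(1) lex_smaller_scalar_mult[OF n(2)], of c] by simp
qed

lemma infinitesimals_uminus: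
  assumes "x \<in> infinitesimals"
  shows "- x \<in> infinitesimals"
proof -
  have "scalar (- 1 :: 'a) = - 1" by (simp add: one_pCons)
  then have "to_fract (scalar (- 1)) = (- 1 :: 'a poly poly fract)"
    by (simp only: to_fract_uminus to_fract_1)
  then show ?thesis using infinitesimals_scalar_mult[OF assms, of "- 1"] by simp
qed

lemma inverse_nonconstant_infinitesimal:
  assumes "f \<notin> range scalar"
  shows "1 / to_fract f \<in> infinitesimals"
proof -
  have "scalar 0 \<in> range (scalar :: 'a \<Rightarrow> _)" by (rule rangeI)
  then have "f \<noteq> 0" using assms by auto
  have "lex_smaller 1 f"
  proof (cases "degree f = 0")
    case True
    then obtain p where p: "f = [:p:]" by (elim degree_eq_zeroE)
    have "degree p \<noteq> 0"
    proof
      assume "degree p = 0"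
      then obtain c where "p = [:c:]" by (elim degree_eq_zeroE)
      with p assms show False by simp
    qed
    then show ?thesis by (simp add: p lex_smaller_def)
  next
    case False
    then show ?thesis by (simp add: lex_smaller_def)
  qed
  then show ?thesis using infinitesimalsI[OF \<open>f \<noteq> 0\<close>, of 1] by simp
qed

lemma scalar_infinitesimal_eq_0:
  assumes "to_fract (scalar c) \<in> infinitesimals"
  shows "c = 0"
proof (rule ccontr)
  assume c: "c \<noteq> 0"
  obtain n d where n: "d \<noteq> 0" "lex_smaller n d" "to_fract (scalar c) = to_fract n / to_fract d"
    using assms unfolding infinitesimals_def by (elim CollectE exE conjE)
  have "to_fract (scalar c) * to_fract d = to_fract n" unfolding n(3) using n(1) by simp
  then have "scalar c * d = n" by (simp only: to_fract_eq_iff flip: to_fract_mult)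
  then have "lex_smaller (scalar c * d) d" using n(2) by (simp only:)
  then show False using n(1) c by (simp add: lex_smaller_def)
qed

section \<open>The reciprocal complement as a subset of the fraction field\<close>

definition recip_ring :: "'a::idom fract set" where
  "recip_ring = generate_ring ring_of_type_algebra {1 / to_fract f | f. f \<noteq> 0}"

lemma a_inv_ring_of_type_algebra: "\<ominus>\<^bsub>ring_of_type_algebra\<^esub> (x::'a::field) = - x"
proof -
  interpret Fields: cring "ring_of_type_algebra :: 'a ring" by (rule cring_from_type_algebra)
  show ?thesis by (rule Fields.minus_equality) (auto simp: ring_of_type_algebra_def)
qed

lemma recip_ring_induct [consumes 1, case_names one recip uminus add mult]:
  assumes "x \<in> recip_ring"
    and "P 1" "\<And>f. f \<noteq> 0 \<Longrightarrow> P (1 / to_fract f)" "\<And>x. P x \<Longrightarrow> P (- x)"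
    and "\<And>x y. P x \<Longrightarrow> P y \<Longrightarrow> P (x + y)" "\<And>x y. P x \<Longrightarrow> P y \<Longrightarrow> P (x * y)"
  shows "P x"
  using assms(1) unfolding recip_ring_def
proof (induction rule: generate_ring.induct)
  case one
  then show ?case using assms(2) by (simp add: ring_of_type_algebra_def)
next
  case (incl h)
  then show ?case using assms(3) by blast
next
  case (a_inv h)
  then show ?case using assms(4) by (simp only: a_inv_ring_of_type_algebra)
next
  case (eng_add h1 h2)
  then show ?case using assms(5) by (simp add: ring_of_type_algebra_def)
next
  case (eng_mult h1 h2)
  then show ?case using assms(6) by (simp add: ring_of_type_algebra_def)
qed

lemma recip_mem: "f \<noteq> 0 \<Longrightarrow> 1 / to_fract f \<in> recip_ring"
  unfolding recip_ring_def by (rule generate_ring.incl) blast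

lemma field_subring_recip_ring: "field_subring (recip_ring :: 'a::idom fract set)"
proof
  show "1 \<in> (recip_ring :: 'a fract set)" using recip_mem[of 1] by simp
  show "x * y \<in> recip_ring" if "x \<in> recip_ring" "y \<in> recip_ring" for x y :: "'a fract"
    using generate_ring.eng_mult[OF that[unfolded recip_ring_def]]
    by (simp add: ring_of_type_algebra_def recip_ring_def)
  fix x y :: "'a fract"
  assume xy: "x \<in> recip_ring" "y \<in> recip_ring"
  have "- y \<in> recip_ring"
    using generate_ring.a_inv[OF xy(2)[unfolded recip_ring_def]]
    by (simp only: a_inv_ring_of_type_algebra recip_ring_def)
  from generate_ring.eng_add[OF xy(1)[unfolded recip_ring_def] this[unfolded recip_ring_def]]
  show "x - y \<in> recip_ring"
    by (simp add: ring_of_type_algebra_def recip_ring_def)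
qed

interpretation R: field_subring "recip_ring :: 'a::idom fract set"
  by (rule field_subring_recip_ring)

lemma recip_scalar: "1 / to_fract (scalar c) = to_fract (scalar (1 / c))"
proof (cases "c = 0")
  case False
  then have "scalar c * scalar (1 / c) = 1" by (simp add: one_pCons)
  then have "to_fract (scalar c) * to_fract (scalar (1 / c)) = 1"
    by (simp only: to_fract_1 flip: to_fract_mult)
  then show ?thesis using False by (simp add: divide_eq_eq mult.commute)
qed simp

lemma scalar_mem_recip_ring: "to_fract (scalar c) \<in> recip_ring"
proof (cases "c = 0")
  case True
  then show ?thesis using R.zero_mem by simp
next
  case False
  then have "1 / to_fract (scalar (1 / c)) \<in> recip_ring" by (intro recip_mem) simp
  then show ?thesis by (simp only: recip_scalar) simp
qed

section \<open>A prime below the ideal of all nonconstant reciprocals\<close>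

lemma zero_infinitesimal: "0 \<in> infinitesimals"
  using infinitesimalsI[of 1 0] by (simp add: lex_smaller_def)

text \<open>
  If an ideal contains all nonconstant reciprocals, then the sums of a constant and an element of
  \<open>P \<inter> infinitesimals\<close> form a ring containing all reciprocals. For an infinitesimal element the
  constant is infinitesimal too, hence 0, so the element lies in \<open>P\<close>.
\<close>

lemma scalar_plus_infinitesimal:
  fixes P :: "'k::field poly poly fract set"
  assumes P: "R.is_ideal P" "\<And>f. f \<notin> range scalar \<Longrightarrow> 1 / to_fract f \<in> P"
    and x: "x \<in> recip_ring"
  shows "\<exists>c. x - to_fract (scalar c) \<in> P \<inter> infinitesimals"
proof -
  define V where "V = P \<inter> infinitesimals"
  have V_zero: "0 \<in> V" using zero_infinitesimal R.ideal_zero[OF P(1)] by (simp add: V_def)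
  have V_add: "y + z \<in> V" if "y \<in> V" "z \<in> V" for y z
    using that by (auto simp: V_def intro: R.ideal_add[OF P(1)] infinitesimals_add)
  have V_uminus: "- y \<in> V" if "y \<in> V" for y
    using that by (auto simp: V_def intro: R.ideal_uminus[OF P(1)] infinitesimals_uminus)
  have V_scalar: "to_fract (scalar c) * y \<in> V" if "y \<in> V" for c y
    using that unfolding V_def
    by (intro IntI R.ideal_mult[OF P(1) scalar_mem_recip_ring] infinitesimals_scalar_mult) simp_all
  have V_mult: "y * z \<in> V" if "y \<in> V" "z \<in> V" for y z
    using that unfolding V_def
    by (intro IntI R.ideal_mult[OF P(1) R.ideal_subset[OF P(1)]] infinitesimals_mult) simp_all
  have "\<exists>c. x - to_fract (scalar c) \<in> V" using x
  proof (induction rule: recip_ring_induct)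
    case one
    show ?case using V_zero by (intro exI[of _ 1]) (simp flip: one_pCons)
  next
    case (recip f)
    show ?case
    proof (cases "f \<in> range scalar")
      case True
      then obtain c where c: "f = scalar c" by (elim rangeE)
      show ?thesis unfolding c recip_scalar using V_zero by (intro exI[of _ "1 / c"]) (simp only: diff_self)
    next
      case False
      then have "1 / to_fract f \<in> V"
        using P(2)[OF False] inverse_nonconstant_infinitesimal[OF False] by (simp add: V_def)
      then show ?thesis by (intro exI[of _ 0]) simp
    qed
  next
    case (uminus x)
    then obtain c where "x - to_fract (scalar c) \<in> V" by (elim exE)
    then have "- (x - to_fract (scalar c)) \<in> V" by (rule V_uminus)
    moreover have "- (x - a) = - x - - a" for a by simp
    ultimately have "- x - - to_fract (scalar c) \<in> V" by metis
    moreover have "scalar (- c) = - scalar c" by simp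
    ultimately have "- x - to_fract (scalar (- c)) \<in> V" by (simp only: to_fract_uminus)
    then show ?case by (rule exI)
  next
    case (add x y)
    then obtain c c' where "x - to_fract (scalar c) \<in> V" "y - to_fract (scalar c') \<in> V"
      by (elim exE)
    then have "(x - to_fract (scalar c)) + (y - to_fract (scalar c')) \<in> V" by (rule V_add)
    moreover have "scalar (c + c') = scalar c + scalar c'" by simp
    ultimately have "x + y - to_fract (scalar (c + c')) \<in> V"
      by (simp only: to_fract_add add_diff_add)
    then show ?case by (rule exI)
  next
    case (mult x y)
    then obtain c c' where c: "x - to_fract (scalar c) \<in> V" "y - to_fract (scalar c') \<in> V"
      by (elim exE)
    define a b where "a = to_fract (scalar c)" and "b = to_fract (scalar c')"
    have "a * (y - b) + b * (x - a) + (x - a) * (y - b) \<in> V"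
      unfolding a_def b_def by (intro V_add V_scalar V_mult c)
    moreover have "a * (y - b) + b * (x - a) + (x - a) * (y - b) = x * y - a * b"
      by (simp add: algebra_simps)
    moreover have "scalar (c * c') = scalar c * scalar c'" by simp
    then have "to_fract (scalar (c * c')) = a * b"
      unfolding a_def b_def by (simp only: to_fract_mult)
    ultimately have "x * y - to_fract (scalar (c * c')) \<in> V" by simp
    then show ?case by (rule exI)
  qed
  then show ?thesis by (simp only: V_def)
qed

text \<open>
  The maximal ideal of the valuation ring of the negated degree in Y, a valuation that the one behind
  \<open>infinitesimals\<close> refines.
\<close>

definition deg_infinitesimals :: "'k::field poly poly fract set" where
  "deg_infinitesimals = {to_fract n / to_fract d | n d.
     d \<noteq> 0 \<and> degree n \<le> degree d \<and> coeff n (degree d) = 0}"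

lemma deg_infinitesimalsI:
  "d \<noteq> 0 \<Longrightarrow> degree n \<le> degree d \<Longrightarrow> coeff n (degree d) = 0
    \<Longrightarrow> to_fract n / to_fract d \<in> deg_infinitesimals"
  unfolding deg_infinitesimals_def by blast

lemma recip_ring_degree_le:
  assumes "x \<in> (recip_ring :: 'k::field poly poly fract set)"
  shows "\<exists>n d. d \<noteq> 0 \<and> x = to_fract n / to_fract d \<and> degree n \<le> degree d"
  using assms
proof (induction rule: recip_ring_induct)
  case one
  show ?case by (intro exI[of _ 1]) simp
next
  case (recip f)
  then show ?case by (intro exI[of _ 1] exI[of _ f]) simp
next
  case (uminus x)
  then obtain n d where "d \<noteq> 0" "x = to_fract n / to_fract d" "degree n \<le> degree d" by blast
  then show ?case by (intro exI[of _ "- n"] exI[of _ d]) simp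
next
  case (add x y)
  then obtain n d n' d' where n: "d \<noteq> 0" "x = to_fract n / to_fract d" "degree n \<le> degree d"
    "d' \<noteq> 0" "y = to_fract n' / to_fract d'" "degree n' \<le> degree d'" by blast
  have "degree (n * d' + n' * d) \<le> degree (d * d')"
    using degree_mult_le[of n d'] degree_mult_le[of n' d] n
    by (intro degree_add_le) (auto simp: degree_mult_eq)
  then show ?case using n
    by (intro exI[of _ "n * d' + n' * d"] exI[of _ "d * d'"]) (simp add: field_simps)
next
  case (mult x y)
  then obtain n d n' d' where n: "d \<noteq> 0" "x = to_fract n / to_fract d" "degree n \<le> degree d"
    "d' \<noteq> 0" "y = to_fract n' / to_fract d'" "degree n' \<le> degree d'" by blast
  have "degree (n * n') \<le> degree (d * d')"
    using degree_mult_le[of n n'] n by (auto simp: degree_mult_eq)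
  then show ?case using n by (intro exI[of _ "n * n'"] exI[of _ "d * d'"]) simp
qed

text \<open>
  Membership does not depend on the fraction that represents the element.
\<close>

lemma deg_infinitesimals_top_coeff:
  assumes "to_fract n / to_fract d \<in> deg_infinitesimals" "d \<noteq> 0" "degree n \<le> degree d"
  shows "coeff n (degree d) = 0"
proof -
  obtain n' d' where n': "d' \<noteq> 0" "degree n' \<le> degree d'" "coeff n' (degree d') = 0"
    "to_fract n / to_fract d = to_fract n' / to_fract d'"
    using assms(1) by (auto simp: deg_infinitesimals_def)
  then have "to_fract (n * d') = to_fract (n' * d)"
    using assms(2) by (simp add: frac_eq_eq)
  then have "n * d' = n' * d" by (simp only: to_fract_eq_iff)
  then have "coeff n (degree d) * lead_coeff d' = coeff n' (degree d') * lead_coeff d"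
    using coeff_mult_at_degree_bounds[OF assms(3) order_refl, of d']
      coeff_mult_at_degree_bounds[OF n'(2) order_refl, of d] by (simp add: add.commute)
  then show ?thesis using n' by simp
qed

text \<open>
  On the fractions n/d with \<open>degree n \<le> degree d\<close>, which include all elements of the
  reciprocal complement, the coefficient of n at the degree of d, divided by the leading coefficient of d, is the residue of n/d
  in the field K(X), and residues are multiplicative.
\<close>

lemma deg_infinitesimals_prime:
  "R.is_prime (recip_ring \<inter> deg_infinitesimals :: 'k::field poly poly fract set)"
  (is "R.is_prime ?Q")
proof -
  have Q_add: "x + y \<in> deg_infinitesimals" if xy: "x \<in> ?Q" "y \<in> ?Q" for x y
  proof -
    obtain n d n' d' where n: "d \<noteq> 0" "x = to_fract n / to_fract d" "degree n \<le> degree d"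
      "coeff n (degree d) = 0" "d' \<noteq> 0" "y = to_fract n' / to_fract d'"
      "degree n' \<le> degree d'" "coeff n' (degree d') = 0"
      using xy by (auto simp: deg_infinitesimals_def)
    have "degree (n * d' + n' * d) \<le> degree (d * d')"
      using degree_mult_le[of n d'] degree_mult_le[of n' d] n
      by (intro degree_add_le) (auto simp: degree_mult_eq)
    moreover have "coeff (n * d' + n' * d) (degree (d * d')) = 0"
      using coeff_mult_at_degree_bounds[OF n(3) order_refl, of d'] n
        coeff_mult_at_degree_bounds[OF n(7) order_refl, of d]
      by (simp add: degree_mult_eq add.commute)
    moreover have "x + y = to_fract (n * d' + n' * d) / to_fract (d * d')"
      using n by (simp add: field_simps)
    moreover have "d * d' \<noteq> 0" using n by simp
    ultimately show ?thesis using deg_infinitesimalsI by metis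
  qed
  have Q_mult: "x * y \<in> deg_infinitesimals" if xy: "x \<in> recip_ring" "y \<in> ?Q" for x y
  proof -
    obtain n d where n: "d \<noteq> 0" "x = to_fract n / to_fract d" "degree n \<le> degree d"
      using recip_ring_degree_le[OF xy(1)] by blast
    obtain n' d' where n': "d' \<noteq> 0" "y = to_fract n' / to_fract d'"
      "degree n' \<le> degree d'" "coeff n' (degree d') = 0"
      using xy by (auto simp: deg_infinitesimals_def)
    have "degree (n * n') \<le> degree (d * d')"
      using degree_mult_le[of n n'] n n' by (auto simp: degree_mult_eq)
    moreover have "coeff (n * n') (degree (d * d')) = 0"
      using coeff_mult_at_degree_bounds[OF n(3) n'(3)] n n' by (simp add: degree_mult_eq)
    moreover have "x * y = to_fract (n * n') / to_fract (d * d')" using n n' by simp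
    moreover have "d * d' \<noteq> 0" using n n' by simp
    ultimately show ?thesis using deg_infinitesimalsI by metis
  qed
  have Q_zero: "0 \<in> deg_infinitesimals"
    using deg_infinitesimalsI[of 1 0] by simp
  have Q_ideal: "R.is_ideal ?Q"
    unfolding R.is_ideal_def
  proof (intro conjI ballI)
    show "?Q \<subseteq> recip_ring" by (rule Int_lower1)
    show "0 \<in> ?Q" by (rule IntI[OF R.zero_mem Q_zero])
    show "x + y \<in> ?Q" if "x \<in> ?Q" "y \<in> ?Q" for x y
      by (rule IntI[OF R.add_mem[OF IntD1[OF that(1)] IntD1[OF that(2)]] Q_add[OF that]])
    show "x * y \<in> ?Q" if "x \<in> recip_ring" "y \<in> ?Q" for x y
      by (rule IntI[OF R.mult_mem[OF that(1) IntD1[OF that(2)]] Q_mult[OF that]])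
  qed
  have Q_proper: "1 \<notin> deg_infinitesimals"
    using deg_infinitesimals_top_coeff[of 1 1] by auto
  have Q_prime: "x \<in> deg_infinitesimals \<or> y \<in> deg_infinitesimals"
    if xy: "x \<in> recip_ring" "y \<in> recip_ring" "x * y \<in> deg_infinitesimals" for x y
  proof -
    obtain n d where n: "d \<noteq> 0" "x = to_fract n / to_fract d" "degree n \<le> degree d"
      using recip_ring_degree_le[OF xy(1)] by blast
    obtain n' d' where n': "d' \<noteq> 0" "y = to_fract n' / to_fract d'" "degree n' \<le> degree d'"
      using recip_ring_degree_le[OF xy(2)] by blast
    have "to_fract (n * n') / to_fract (d * d') \<in> deg_infinitesimals"
      using xy(3) n n' by simp
    moreover have "degree (n * n') \<le> degree (d * d')"
      using degree_mult_le[of n n'] n n' by (auto simp: degree_mult_eq)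
    moreover have "d * d' \<noteq> 0" using n n' by simp
    ultimately have "coeff (n * n') (degree (d * d')) = 0"
      by (intro deg_infinitesimals_top_coeff)
    then have "coeff n (degree d) = 0 \<or> coeff n' (degree d') = 0"
      using coeff_mult_at_degree_bounds[OF n(3) n'(3)] n n' by (simp add: degree_mult_eq)
    then show ?thesis using n n' by (auto intro: deg_infinitesimalsI)
  qed
  show ?thesis
    unfolding R.is_prime_def
  proof (intro conjI ballI impI)
    show "R.is_ideal ?Q" by (rule Q_ideal)
    show "1 \<notin> ?Q" using Q_proper by blast
    show "x \<in> ?Q \<or> y \<in> ?Q" if "x \<in> recip_ring" "y \<in> recip_ring" "x * y \<in> ?Q" for x y
      using Q_prime[OF that(1,2) IntD2[OF that(3)]] that(1,2) by simp
  qed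
qed

section \<open>Height\<close>

lemma reciprocal_complement_eq:
  "reciprocal_complement TYPE('a::idom) = ring_of_type_algebra\<lparr>carrier := recip_ring\<rparr>"
  by (simp only: reciprocal_complement_def Let_def recip_ring_def)

lemma height_zero_ideal: "height R {\<zero>\<^bsub>R\<^esub>} = 0"
proof -
  have "n = 0" if "prime_chain R n Q" "Q n = {\<zero>\<^bsub>R\<^esub>}" for n Q
  proof (rule ccontr)
    assume "n \<noteq> 0"
    then obtain m where m: "n = Suc m" by (cases n) auto
    then have "m \<le> n" "m < n" by simp_all
    then have "primeideal (Q m) R" and lt: "Q m \<subset> Q n"
      using that(1) unfolding prime_chain_def m by blast+
    then have "ideal (Q m) R" by (intro primeideal.axioms(1))
    then have "\<zero>\<^bsub>R\<^esub> \<in> Q m"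
      by (intro additive_subgroup.zero_closed ideal.axioms(1))
    with lt that(2) show False by auto
  qed
  note length_zero = this
  have "height R {\<zero>\<^bsub>R\<^esub>} \<le> 0"
    unfolding height_def
  proof (rule SUP_least)
    fix n assume "n \<in> {n. \<exists>Q. prime_chain R n Q \<and> Q n = {\<zero>\<^bsub>R\<^esub>}}"
    then obtain Q where "prime_chain R n Q" "Q n = {\<zero>\<^bsub>R\<^esub>}" by (elim CollectE exE conjE)
    then have "n = 0" by (rule length_zero)
    then show "enat n \<le> 0" by (simp add: zero_enat_def)
  qed
  then show ?thesis by simp
qed

lemma height_one_no_between:
  assumes "height R P = 1" "primeideal Q0 R" "primeideal Q R" "primeideal P R"
    and "Q0 \<subset> Q" "Q \<subset> P"
  shows False
proof -
  define C where "C = (\<lambda>i::nat. if i = 0 then Q0 else if i = 1 then Q else P)"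
  have "prime_chain R 2 C"
    using assms(2-6) by (simp add: prime_chain_def C_def numeral_2_eq_2 less_Suc_eq)
  moreover have "C 2 = P" by (simp add: C_def)
  ultimately have "enat 2 \<le> height R P"
    unfolding height_def by (intro SUP_upper CollectI exI[of _ C]) simp
  then show False using assms(1) by (simp add: one_enat_def)
qed

section \<open>Localization of the reciprocal complement at a prime\<close>

locale recip_prime =
  fixes P :: "'k::field poly poly fract set"
  assumes prime: "R.is_prime P"
begin

lemma P_ideal: "R.is_ideal P"
  using prime by (simp add: R.is_prime_def)

lemma P_proper: "1 \<notin> P"
  using prime by (simp add: R.is_prime_def)

lemma P_prime: "x \<in> recip_ring \<Longrightarrow> y \<in> recip_ring \<Longrightarrow> x * y \<in> P \<Longrightarrow> x \<in> P \<or> y \<in> P"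
  using prime by (simp add: R.is_prime_def)

definition loc :: "'k poly poly fract set" where
  "loc = {a / s | a s. a \<in> recip_ring \<and> s \<in> recip_ring - P}"

definition max_ideal :: "'k poly poly fract set" where
  "max_ideal = {a / s | a s. a \<in> P \<and> s \<in> recip_ring - P}"

text \<open>
  The polynomials that become units in the localization, together with 0.
\<close>

definition inverted :: "'k poly poly set" where
  "inverted = {f. f = 0 \<or> 1 / to_fract f \<notin> P}"

lemma locI: "a \<in> recip_ring \<Longrightarrow> s \<in> recip_ring \<Longrightarrow> s \<notin> P \<Longrightarrow> a / s \<in> loc"
  unfolding loc_def by blast

lemma locE:
  assumes "x \<in> loc"
  obtains a s where "a \<in> recip_ring" "s \<in> recip_ring" "s \<notin> P" "s \<noteq> 0" "x = a / s"
  using assms R.ideal_zero[OF P_ideal] unfolding loc_def by blast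

lemma max_idealI: "a \<in> P \<Longrightarrow> s \<in> recip_ring \<Longrightarrow> s \<notin> P \<Longrightarrow> a / s \<in> max_ideal"
  unfolding max_ideal_def by blast

lemma max_idealE:
  assumes "x \<in> max_ideal"
  obtains a s where "a \<in> P" "s \<in> recip_ring" "s \<notin> P" "s \<noteq> 0" "x = a / s"
  using assms R.ideal_zero[OF P_ideal] unfolding max_ideal_def by blast

lemma denominators_mult:
  assumes "s \<in> recip_ring" "s \<notin> P" "t \<in> recip_ring" "t \<notin> P"
  shows "s * t \<in> recip_ring" "s * t \<notin> P"
  using assms P_prime R.mult_mem by blast+

lemma recip_ring_subset_loc: "x \<in> recip_ring \<Longrightarrow> x \<in> loc"
  using locI[OF _ R.one_mem P_proper, of x] by simp

sublocale L: field_subring loc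
proof
  show "1 \<in> loc" by (rule recip_ring_subset_loc[OF R.one_mem])
next
  fix x y assume "x \<in> loc" "y \<in> loc"
  then obtain a s b t where a: "a \<in> recip_ring" "s \<in> recip_ring" "s \<notin> P" "s \<noteq> 0" "x = a / s"
    and b: "b \<in> recip_ring" "t \<in> recip_ring" "t \<notin> P" "t \<noteq> 0" "y = b / t"
    by (elim locE)
  have "x - y = (a * t - b * s) / (s * t)" using a b by (simp add: diff_frac_eq)
  moreover have "a * t - b * s \<in> recip_ring" by (intro R.diff_mem R.mult_mem a b)
  ultimately show "x - y \<in> loc" using locI denominators_mult[OF a(2,3) b(2,3)] by metis
  have "x * y = (a * b) / (s * t)" using a b by simp
  moreover have "a * b \<in> recip_ring" by (intro R.mult_mem a b)
  ultimately show "x * y \<in> loc" using locI denominators_mult[OF a(2,3) b(2,3)] by metis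
qed

lemma max_ideal_ideal: "L.is_ideal max_ideal"
  unfolding L.is_ideal_def
proof (intro conjI ballI)
  show "max_ideal \<subseteq> loc"
    unfolding max_ideal_def loc_def using R.ideal_subset[OF P_ideal] by blast
  show "0 \<in> max_ideal" using max_idealI[OF R.ideal_zero[OF P_ideal] R.one_mem P_proper] by simp
next
  fix x y assume "x \<in> max_ideal" "y \<in> max_ideal"
  then obtain a s b t where a: "a \<in> P" "s \<in> recip_ring" "s \<notin> P" "s \<noteq> 0" "x = a / s"
    and b: "b \<in> P" "t \<in> recip_ring" "t \<notin> P" "t \<noteq> 0" "y = b / t"
    by (elim max_idealE)
  have "x + y = (t * a + s * b) / (s * t)" using a b by (simp add: add_frac_eq mult.commute)
  moreover have "t * a + s * b \<in> P" by (intro R.ideal_add R.ideal_mult P_ideal a b)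
  ultimately show "x + y \<in> max_ideal"
    using max_idealI denominators_mult[OF a(2,3) b(2,3)] by metis
next
  fix x y assume "x \<in> loc" "y \<in> max_ideal"
  then obtain a s b t where a: "a \<in> recip_ring" "s \<in> recip_ring" "s \<notin> P" "s \<noteq> 0" "x = a / s"
    and b: "b \<in> P" "t \<in> recip_ring" "t \<notin> P" "t \<noteq> 0" "y = b / t"
    by (elim locE max_idealE)
  have "x * y = (a * b) / (s * t)" using a b by simp
  moreover have "a * b \<in> P" by (intro R.ideal_mult P_ideal a b)
  ultimately show "x * y \<in> max_ideal"
    using max_idealI denominators_mult[OF a(2,3) b(2,3)] by metis
qed

lemma P_subset_max_ideal: "P \<subseteq> max_ideal"
  using max_idealI[OF _ R.one_mem P_proper] by fastforce

lemma max_ideal_proper: "1 \<notin> max_ideal"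
proof
  assume "1 \<in> max_ideal"
  then obtain a s where "a \<in> P" "s \<notin> P" "s \<noteq> 0" "1 = a / s" by (elim max_idealE)
  moreover from this have "a = s" by (simp add: eq_divide_eq)
  ultimately show False by simp
qed

lemma unit_outside_max_ideal:
  assumes "x \<in> loc" "x \<notin> max_ideal"
  shows "1 / x \<in> loc"
proof -
  obtain a s where a: "a \<in> recip_ring" "s \<in> recip_ring" "s \<notin> P" "s \<noteq> 0" "x = a / s"
    using assms(1) by (elim locE)
  then have "a \<notin> P" using assms(2) max_idealI by blast
  then have "s / a \<in> loc" using locI a by blast
  then show ?thesis by (simp add: a)
qed

lemma proper_ideal_subset_max_ideal:
  assumes "L.is_ideal I" "1 \<notin> I"
  shows "I \<subseteq> max_ideal"
proof
  fix x assume x: "x \<in> I"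
  show "x \<in> max_ideal"
  proof (rule ccontr)
    assume nx: "x \<notin> max_ideal"
    then have "1 / x \<in> loc" using unit_outside_max_ideal L.ideal_subset[OF assms(1) x] by blast
    then have "1 / x * x \<in> I" using L.ideal_mult[OF assms(1) _ x] by blast
    moreover have "x \<noteq> 0" using nx L.ideal_zero[OF max_ideal_ideal] by auto
    ultimately show False using assms(2) by simp
  qed
qed

lemma max_ideal_prime: "L.is_prime max_ideal"
  unfolding L.is_prime_def
proof (intro conjI ballI impI)
  fix x y assume x: "x \<in> loc" "y \<in> loc" "x * y \<in> max_ideal"
  show "x \<in> max_ideal \<or> y \<in> max_ideal"
  proof (rule ccontr)
    assume n: "\<not> (x \<in> max_ideal \<or> y \<in> max_ideal)"
    then have "1 / x * (1 / y) \<in> loc"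
      using unit_outside_max_ideal x by (intro L.mult_mem) auto
    then have "1 / x * (1 / y) * (x * y) \<in> max_ideal"
      using L.ideal_mult[OF max_ideal_ideal _ x(3)] by blast
    moreover have "x \<noteq> 0" "y \<noteq> 0" using n L.ideal_zero[OF max_ideal_ideal] by auto
    ultimately show False using max_ideal_proper by simp
  qed
qed (use max_ideal_ideal max_ideal_proper in auto)

lemma local_ring_loc: "local_ring L.ring_on"
proof -
  have "maximalideal max_ideal L.ring_on"
  proof (rule maximalidealI)
    show "ideal max_ideal L.ring_on" using max_ideal_ideal by (simp only: L.ideal_ring_on_iff)
    show "carrier L.ring_on \<noteq> max_ideal" using max_ideal_proper L.one_mem by auto
    fix J assume J: "ideal J L.ring_on" "max_ideal \<subseteq> J"
    then have "L.is_ideal J" by (simp only: L.ideal_ring_on_iff)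
    then show "J = max_ideal \<or> J = carrier L.ring_on"
      using J(2) proper_ideal_subset_max_ideal[of J] L.ideal_eq_carrier[of J] by auto
  qed
  moreover have "N = max_ideal" if "maximalideal N L.ring_on" for N
  proof -
    interpret N: maximalideal N L.ring_on by (rule that)
    have N: "L.is_ideal N" using N.is_ideal by (simp only: L.ideal_ring_on_iff)
    have "1 \<notin> N" using N.I_notcarr L.ideal_eq_carrier[OF N] by auto
    then have "N \<subseteq> max_ideal" by (rule proper_ideal_subset_max_ideal[OF N])
    moreover have "max_ideal \<noteq> carrier L.ring_on" using max_ideal_proper L.one_mem by auto
    moreover have "ideal max_ideal L.ring_on"
      using max_ideal_ideal by (simp only: L.ideal_ring_on_iff)
    ultimately show ?thesis
      using N.I_maximal[of max_ideal] L.ideal_subset[OF max_ideal_ideal] by auto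
  qed
  ultimately have "\<exists>!M. maximalideal M L.ring_on" by blast
  then show ?thesis by (intro local_ring.intro local_ring_axioms.intro L.R.is_cring)
qed

text \<open>
  Closure under addition comes from the identity
  1/a * 1/b = 1/(a+b) * (1/a + 1/b): if the first factor on the right were in \<open>P\<close>, one of the factors
  on the left would be.
\<close>

lemma inverted_factorially_closed: "factorially_closed inverted"
proof
  fix c
  show "scalar c \<in> inverted"
  proof (rule ccontr)
    assume "scalar c \<notin> inverted"
    then have c: "c \<noteq> 0" "1 / to_fract (scalar c) \<in> P" by (auto simp: inverted_def)
    have "to_fract (scalar c) * (1 / to_fract (scalar c)) \<in> P"
      by (rule R.ideal_mult[OF P_ideal scalar_mem_recip_ring c(2)])
    with c(1) P_proper show False by simp
  qed
next
  fix a b assume ab: "a \<in> inverted" "b \<in> inverted"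
  show "a + b \<in> inverted"
  proof (cases "a = 0 \<or> b = 0 \<or> a + b = 0")
    case False
    then have nz: "a \<noteq> 0" "b \<noteq> 0" "a + b \<noteq> 0" "to_fract a + to_fract b \<noteq> 0"
      by (simp_all flip: to_fract_add)
    have "1 / to_fract (a + b) \<notin> P"
    proof
      assume "1 / to_fract (a + b) \<in> P"
      then have "(1 / to_fract a + 1 / to_fract b) * (1 / to_fract (a + b)) \<in> P"
        using nz by (intro R.ideal_mult P_ideal R.add_mem recip_mem)
      moreover have "(1 / to_fract a + 1 / to_fract b) * (1 / to_fract (a + b)) =
          1 / to_fract a * (1 / to_fract b)"
        using nz by (simp add: field_simps)
      ultimately have "1 / to_fract a * (1 / to_fract b) \<in> P" by metis
      then show False
        using P_prime[OF recip_mem[OF nz(1)] recip_mem[OF nz(2)]] ab nz by (auto simp: inverted_def)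
    qed
    then show ?thesis by (simp add: inverted_def)
  qed (use ab in \<open>auto simp: inverted_def\<close>)
  show "a * b \<in> inverted"
  proof (cases "a = 0 \<or> b = 0")
    case False
    then have "1 / to_fract a * (1 / to_fract b) \<notin> P"
      using denominators_mult(2)[of "1 / to_fract a" "1 / to_fract b"] recip_mem ab
      by (auto simp: inverted_def)
    then show ?thesis by (simp add: inverted_def)
  qed (auto simp: inverted_def)
next
  fix a b assume ab: "a * b \<in> inverted" "a * b \<noteq> 0"
  show "a \<in> inverted"
  proof (rule ccontr)
    assume "a \<notin> inverted"
    then have "1 / to_fract a \<in> P" by (simp add: inverted_def)
    moreover have "1 / to_fract b \<in> recip_ring" using ab(2) by (intro recip_mem) auto
    ultimately have "1 / to_fract b * (1 / to_fract a) \<in> P" by (intro R.ideal_mult P_ideal)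
    then show False using ab by (simp add: inverted_def mult.commute)
  qed
qed

end

section \<open>Primes of height one\<close>

locale height_one = recip_prime P for P :: "'k::field poly poly fract set" +
  assumes height: "height R.ring_on P = 1"
begin

lemma nonzero_subprime_eq:
  assumes "R.is_prime Q" "Q \<noteq> {0}" "Q \<subseteq> P"
  shows "Q = P"
proof (rule ccontr)
  assume "Q \<noteq> P"
  have "R.is_ideal Q" using assms(1) by (simp add: R.is_prime_def)
  then have "0 \<in> Q" by (rule R.ideal_zero)
  then have "{\<zero>\<^bsub>R.ring_on\<^esub>} \<subset> Q" using assms(2) by (auto simp: ring_of_type_algebra_def)
  then show False
    using height_one_no_between[OF height R.R.zeroprimeideal, of Q] assms \<open>Q \<noteq> P\<close> prime
    by (auto simp: R.primeideal_ring_on_iff)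
qed

lemma P_nonzero: "P \<noteq> {0}"
proof
  assume "P = {0}"
  then have "P = {\<zero>\<^bsub>R.ring_on\<^esub>}" by (simp add: ring_of_type_algebra_def)
  then have "height R.ring_on P = 0" using height_zero_ideal[of R.ring_on] by metis
  with height show False by simp
qed

lemma exists_not_inverted: "\<exists>f. f \<notin> inverted"
proof -
  obtain x where x: "x \<in> P" "x \<noteq> 0" using P_nonzero R.ideal_zero[OF P_ideal] by auto
  obtain n d where n: "d \<noteq> 0" "x = to_fract n / to_fract d" by (rule fract_obtain)
  with x have "n \<noteq> 0" by auto
  then have "1 / to_fract n * x \<in> P" by (intro R.ideal_mult P_ideal recip_mem x)
  then have "1 / to_fract d \<in> P" using n \<open>n \<noteq> 0\<close> by simp
  then show ?thesis using n(1) by (auto simp: inverted_def)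
qed

text \<open>
  Otherwise \<open>P\<close> contains all nonconstant reciprocals. An element of \<open>deg_infinitesimals\<close> in the
  reciprocal complement is infinitesimal, and it is a constant plus an infinitesimal in \<open>P\<close>; so the
  constant is infinitesimal, hence 0. Thus a nonzero prime lies inside \<open>P\<close>, and it is not \<open>P\<close> because
  it misses 1/X.
\<close>

lemma exists_inverted_nonconstant: "\<exists>g. g \<in> inverted \<and> g \<notin> range scalar"
proof (rule ccontr)
  assume contra: "\<nexists>g. g \<in> inverted \<and> g \<notin> range scalar"
  then have all: "1 / to_fract f \<in> P" if "f \<notin> range scalar" for f
    using that by (auto simp: inverted_def)
  let ?Q = "recip_ring \<inter> deg_infinitesimals :: 'k poly poly fract set"
  have "?Q \<subseteq> P"
  proof
    fix x assume x: "x \<in> ?Q"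
    then obtain c where c: "x - to_fract (scalar c) \<in> P \<inter> infinitesimals"
      using scalar_plus_infinitesimal[OF P_ideal all, of x] by blast
    obtain n d where n: "d \<noteq> 0" "x = to_fract n / to_fract d" "degree n \<le> degree d"
      "coeff n (degree d) = 0"
      using x unfolding deg_infinitesimals_def by blast
    then have "x \<in> infinitesimals" unfolding n(2) by (intro infinitesimalsI) (auto simp: lex_smaller_def)
    then have "x + - (x - to_fract (scalar c)) \<in> infinitesimals"
      using c by (intro infinitesimals_add infinitesimals_uminus) auto
    then have "to_fract (scalar c) \<in> infinitesimals" by simp
    then have "c = 0" by (rule scalar_infinitesimal_eq_0)
    with c show "x \<in> P" by simp
  qed
  moreover have "?Q \<noteq> {0}"
  proof -
    have "1 / to_fract [:0, 1:] \<in> ?Q"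
      using deg_infinitesimalsI[of "[:0, 1:]" 1] recip_mem[of "[:0, 1:]"] by simp
    moreover have "1 / to_fract [:0, 1:] \<noteq> (0 :: 'k poly poly fract)" by simp
    ultimately show ?thesis by (metis singletonD)
  qed
  ultimately have "?Q = P" by (intro nonzero_subprime_eq deg_infinitesimals_prime)
  moreover have "[:[:0, 1:]:] \<notin> range (scalar :: 'k \<Rightarrow> _)" by auto
  then have "1 / to_fract [:[:0, 1:]:] \<in> P" by (rule all)
  ultimately have "to_fract 1 / to_fract [:[:0, 1:]:] \<in> (deg_infinitesimals :: 'k poly poly fract set)"
    by auto
  then have "coeff (1 :: 'k poly poly) (degree [:[:0, 1 :: 'k:]:]) = 0"
    by (rule deg_infinitesimals_top_coeff) auto
  then show False by simp
qed

lemma noetherian_domain_loc: "noetherian_domain L.ring_on"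
proof -
  obtain f where f: "f \<notin> inverted" using exists_not_inverted by blast
  obtain g where g: "g \<in> inverted" "g \<notin> range scalar" using exists_inverted_nonconstant by blast
  interpret A: factorially_closed inverted by (rule inverted_factorially_closed)
  interpret reciprocal_localization loc inverted f g
  proof
    show "1 / to_fract h \<in> loc" if "h \<noteq> 0" for h
      by (rule recip_ring_subset_loc[OF recip_mem[OF that]])
    show "to_fract a \<in> loc" if "a \<in> inverted" for a
    proof (cases "a = 0")
      case False
      then have "1 / (1 / to_fract a) \<in> loc"
        using that by (intro locI R.one_mem recip_mem) (auto simp: inverted_def)
      then show ?thesis by simp
    qed (simp add: L.zero_mem)
  qed (use f g in auto)
  show ?thesis by (rule noetherian)
qed

text \<open>
  The contraction of \<open>Q\<close> to the reciprocal complement is a nonzero prime inside \<open>P\<close>, so it is \<open>P\<close> by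
  the height hypothesis.
\<close>

lemma nonzero_prime_eq_max_ideal:
  assumes Q: "L.is_prime Q" "Q \<noteq> {0}"
  shows "Q = max_ideal"
proof -
  have Qi: "L.is_ideal Q" "1 \<notin> Q" using Q(1) by (simp_all add: L.is_prime_def)
  have sub: "Q \<subseteq> max_ideal" by (rule proper_ideal_subset_max_ideal[OF Qi])
  let ?Q = "Q \<inter> recip_ring"
  have "R.is_prime ?Q"
    unfolding R.is_prime_def R.is_ideal_def
  proof (intro conjI ballI impI)
    show "0 \<in> ?Q" using L.ideal_zero[OF Qi(1)] R.zero_mem by blast
    show "1 \<notin> ?Q" using Qi(2) by blast
    show "x + y \<in> ?Q" if "x \<in> ?Q" "y \<in> ?Q" for x y
      using that L.ideal_add[OF Qi(1)] R.add_mem by blast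
    show "x * y \<in> ?Q" if "x \<in> recip_ring" "y \<in> ?Q" for x y
      using that L.ideal_mult[OF Qi(1)] recip_ring_subset_loc R.mult_mem by blast
    show "x \<in> ?Q \<or> y \<in> ?Q" if "x \<in> recip_ring" "y \<in> recip_ring" "x * y \<in> ?Q" for x y
      using that Q(1) recip_ring_subset_loc unfolding L.is_prime_def by blast
  qed auto
  moreover have "?Q \<noteq> {0}"
  proof -
    obtain x where x: "x \<in> Q" "x \<noteq> 0" using Q(2) L.ideal_zero[OF Qi(1)] by auto
    obtain a s where a: "a \<in> recip_ring" "s \<in> recip_ring" "s \<notin> P" "s \<noteq> 0" "x = a / s"
      using L.ideal_subset[OF Qi(1) x(1)] by (elim locE)
    have "s * x \<in> Q" using L.ideal_mult[OF Qi(1) recip_ring_subset_loc[OF a(2)] x(1)] .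
    then have "a \<in> ?Q" using a by simp
    moreover have "a \<noteq> 0" using a x by auto
    ultimately show ?thesis by blast
  qed
  moreover have "?Q \<subseteq> P"
  proof
    fix x assume x: "x \<in> ?Q"
    then have "x \<in> max_ideal" using sub by blast
    then obtain a s where a: "a \<in> P" "s \<in> recip_ring" "s \<notin> P" "s \<noteq> 0" "x = a / s"
      by (elim max_idealE)
    then have "s * x \<in> P" by simp
    then show "x \<in> P" using P_prime[of s x] a x by blast
  qed
  ultimately have "?Q = P" by (rule nonzero_subprime_eq)
  have "max_ideal \<subseteq> Q"
  proof
    fix x assume "x \<in> max_ideal"
    then obtain a s where a: "a \<in> P" "s \<in> recip_ring" "s \<notin> P" "x = a / s" by (elim max_idealE)
    then have "1 / s * a \<in> Q"
      using \<open>?Q = P\<close> by (intro L.ideal_mult[OF Qi(1)] locI R.one_mem) auto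
    then show "x \<in> Q" using a by simp
  qed
  with sub show ?thesis by blast
qed

lemma krull_dim_loc: "krull_dim L.ring_on = 1"
proof (rule antisym)
  show "krull_dim L.ring_on \<le> 1"
    unfolding krull_dim_def
  proof (rule SUP_least)
    fix n assume "n \<in> {n. \<exists>Q. prime_chain L.ring_on n Q}"
    then obtain Q where Q: "prime_chain L.ring_on n Q" by (elim CollectE exE)
    have "n \<le> 1"
    proof (rule ccontr)
      assume "\<not> n \<le> 1"
      then have n: "0 < n" "1 < n" "1 \<le> n" "2 \<le> n" by auto
      note chain = Q[unfolded prime_chain_def, THEN conjunct1, rule_format]
        Q[unfolded prime_chain_def, THEN conjunct2, rule_format]
      have p: "L.is_prime (Q i)" if "i \<le> n" for i
        using chain(1)[OF that] by (simp only: L.primeideal_ring_on_iff)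
      have lt: "Q 0 \<subset> Q 1" "Q 1 \<subset> Q 2"
        using chain(2)[OF n(1)] chain(2)[OF n(2)] by (simp_all only: One_nat_def numeral_2_eq_2)
      have zero: "0 \<in> Q i" if "i \<le> n" for i
        using p[OF that] L.ideal_zero[of "Q i"] by (simp add: L.is_prime_def)
      have "0 \<in> Q 0" "0 \<in> Q 1" using zero[of 0] zero[OF n(3)] by simp_all
      moreover have "B \<noteq> {0}" if "0 \<in> A" "A \<subset> B" for A B :: "'k poly poly fract set"
        using that by auto
      ultimately have nz: "Q 1 \<noteq> {0}" "Q 2 \<noteq> {0}" using lt by metis+
      have "Q 1 = max_ideal" by (rule nonzero_prime_eq_max_ideal[OF p[OF n(3)] nz(1)])
      moreover have "Q 2 = max_ideal" by (rule nonzero_prime_eq_max_ideal[OF p[OF n(4)] nz(2)])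
      ultimately show False using lt by simp
    qed
    then show "enat n \<le> 1" by (simp add: one_enat_def)
  qed
next
  define C where "C = (\<lambda>i::nat. if i = 0 then {\<zero>\<^bsub>L.ring_on\<^esub>} else max_ideal)"
  obtain x where x: "x \<in> P" "x \<noteq> 0" using P_nonzero R.ideal_zero[OF P_ideal] by auto
  have "{0} \<subset> max_ideal"
  proof (rule psubsetI)
    show "{0} \<subseteq> max_ideal" using L.ideal_zero[OF max_ideal_ideal] by simp
    show "{0} \<noteq> max_ideal" using x subsetD[OF P_subset_max_ideal x(1)] by auto
  qed
  then have "{\<zero>\<^bsub>L.ring_on\<^esub>} \<subset> max_ideal"
    by (simp add: ring_of_type_algebra_def)
  moreover have "primeideal max_ideal L.ring_on"
    using max_ideal_prime by (simp only: L.primeideal_ring_on_iff)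
  ultimately have "prime_chain L.ring_on 1 C"
    using L.R.zeroprimeideal by (simp add: prime_chain_def C_def)
  then have "1 \<in> {n. \<exists>Q. prime_chain L.ring_on n Q}" by (intro CollectI exI[of _ C])
  then have "enat 1 \<le> krull_dim L.ring_on"
    unfolding krull_dim_def by (rule SUP_upper)
  then show "1 \<le> krull_dim L.ring_on" by (simp add: one_enat_def)
qed

end

theorem theorem7p3:
  fixes P :: "'k::field poly poly fract set"
  assumes "primeideal P (reciprocal_complement TYPE('k poly poly))"
    and "height (reciprocal_complement TYPE('k poly poly)) P = 1"
  shows "noetherian_domain (localization_at (reciprocal_complement TYPE('k poly poly)) P) \<and>
         krull_dim (localization_at (reciprocal_complement TYPE('k poly poly)) P) = 1 \<and>
         local_ring (localization_at (reciprocal_complement TYPE('k poly poly)) P)"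
proof -
  interpret height_one P
  proof
    show "R.is_prime P"
      using assms(1) by (simp only: reciprocal_complement_eq R.primeideal_ring_on_iff)
    show "height R.ring_on P = 1" using assms(2) by (simp only: reciprocal_complement_eq)
  qed
  have "localization_at (reciprocal_complement TYPE('k poly poly)) P = L.ring_on"
    by (simp add: localization_at_def reciprocal_complement_eq loc_def)
  then show ?thesis
    using noetherian_domain_loc krull_dim_loc local_ring_loc by simp
qed

end
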